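(* Let $p$ be an odd prime and let $r\ge1$. Let $\mathcal{X}_{\Gamma_{p^r}}$ be the flat manifold of dimension $\frac{p^r(p^r-1)}{2}$ with fundamental group the Bieberbach group $\Gamma_{p^r}\le B_{p^r}/[P_{p^r},P_{p^r}]$ (defined in the context) and holonomy group $\mathbb{Z}_{p^r}$. Then the flat manifold $\mathcal{X}_{\Gamma_{p^r}}$ is Kähler if and only if there is an integer $u\ge1$ such that $p^r=4u+1$.
   Context: $B_n$ is the Artin braid group with standard generators $\sigma_1,\ldots,\sigma_{n-1}$, $P_n$ is the pure braid group (kernel of $\sigma\colon B_n\to S_n$, $\sigma_i\mapsto(i,\,i+1)$), and $[P_n,P_n]$ its commutator subgroup. For $1\le i<j\le n$, $A_{i,j}=\sigma_{j-1}\cdots\sigma_{i+1}\sigma_i^2\sigma_{i+1}^{-1}\cdots\sigma_{j-1}^{-1}$; the same symbol denotes its class in $B_n/[P_n,P_n]$. The classes $A_{i,j}$ form a basis of the free abelian group $P_n/[P_n,P_n]\cong\mathbb{Z}^{n(n-1)/2}$. Definition of $\Gamma_{p^r}$: put $n=p^r$ and $$\delta_{0,n}=\sigma_{n-1}\cdots\sigma_{\frac{n+1}{2}}\,\sigma_{\frac{n-1}{2}}^{-1}\cdots\sigma_{1}^{-1}\in B_n/[P_n,P_n].$$ $\Gamma_{p^r}$ is the subgroup of $B_{n}/[P_{n},P_{n}]$ generated by $A_{1,2}\,\delta_{0,n}$ and the elements $A_{a,b}^{p^r}$ for $1\le a<b\le n$. It is a Bieberbach group (torsion-free crystallographic group)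 of dimension $n(n-1)/2$ with holonomy group $\mathbb{Z}_{p^r}$. A flat manifold is a closed Riemannian manifold of zero curvature; to each Bieberbach group $\Gamma$ of dimension $N$ corresponds the closed flat $N$-manifold $\mathcal{X}_\Gamma$ with fundamental group $\Gamma$. A Kähler manifold is a $2m$-real-dimensional manifold endowed with a Riemannian metric, a complex structure and a symplectic structure which are compatible at every point; "$\mathcal{X}_\Gamma$ is Kähler" means that it admits such a structure. *)

theory Defs
  imports "HOL-Analysis.Analysis" "HOL-Algebra.Generated_Groups" "HOL-Algebra.Sym_Groups"
begin

section \<open>Artin braid groups\<close>

text \<open>
  The letter \<open>(i, True)\<close> stands for \<open>\<sigma>\<^sub>i\<close> and \<open>(i, False)\<close> for its inverse.  The braid group is the
  group of words modulo the congruence generated by free cancellation and the Artin relations.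
\<close>

type_synonym braid_word = "(nat \<times> bool) list"

definition braid_words :: "nat \<Rightarrow> braid_word set" where
  "braid_words n = lists ({1..<n} \<times> UNIV)"

inductive braid_equiv :: "nat \<Rightarrow> braid_word \<Rightarrow> braid_word \<Rightarrow> bool" for n :: nat where
  refl: "u \<in> braid_words n \<Longrightarrow> braid_equiv n u u"
| sym: "braid_equiv n u v \<Longrightarrow> braid_equiv n v u"
| trans: "braid_equiv n u v \<Longrightarrow> braid_equiv n v w \<Longrightarrow> braid_equiv n u w"
| cong: "braid_equiv n u v \<Longrightarrow> a \<in> braid_words n \<Longrightarrow> b \<in> braid_words n
      \<Longrightarrow> braid_equiv n (a @ u @ b) (a @ v @ b)"
| cancel: "i \<in> {1..<n} \<Longrightarrow> braid_equiv n [(i, e), (i, \<not> e)] []"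
| far_comm: "i \<in> {1..<n} \<Longrightarrow> j \<in> {1..<n} \<Longrightarrow> i + 2 \<le> j
      \<Longrightarrow> braid_equiv n [(i, True), (j, True)] [(j, True), (i, True)]"
| braid: "i \<in> {1..<n} \<Longrightarrow> i + 1 \<in> {1..<n}
      \<Longrightarrow> braid_equiv n [(i, True), (i + 1, True), (i, True)] [(i + 1, True), (i, True), (i + 1, True)]"

definition braid_rel :: "nat \<Rightarrow> (braid_word \<times> braid_word) set" where
  "braid_rel n = {(u, v). braid_equiv n u v}"

definition braid_of :: "nat \<Rightarrow> braid_word \<Rightarrow> braid_word set" where
  "braid_of n w = braid_rel n `` {w}"

definition braid_group :: "nat \<Rightarrow> braid_word set monoid" where
  "braid_group n = \<lparr> carrier = braid_words n // braid_rel n,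
                     mult = (\<lambda>X Y. \<Union>x\<in>X. \<Union>y\<in>Y. braid_of n (x @ y)),
                     one = braid_of n [] \<rparr>"

definition word_perm :: "braid_word \<Rightarrow> nat \<Rightarrow> nat" where
  "word_perm w = foldr (\<lambda>(i, e) f. Transposition.transpose i (i + 1) \<circ> f) w id"

definition braid_perm :: "braid_word set \<Rightarrow> nat \<Rightarrow> nat" where
  "braid_perm X = the_elem (word_perm ` X)"

definition pure_braid_group :: "nat \<Rightarrow> braid_word set set" where
  "pure_braid_group n = kernel (braid_group n) (sym_group n) braid_perm"

definition pure_commutator :: "nat \<Rightarrow> braid_word set set" where
  "pure_commutator n = derived (braid_group n) (pure_braid_group n)"

definition braid_quotient :: "nat \<Rightarrow> braid_word set set monoid" where
  "braid_quotient n = braid_group n Mod pure_commutator n"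

definition quotient_class :: "nat \<Rightarrow> braid_word \<Rightarrow> braid_word set set" where
  "quotient_class n w = pure_commutator n #>\<^bsub>braid_group n\<^esub> braid_of n w"

subsection \<open>Well-definedness\<close>

lemma braid_words_append [simp]:
  "u @ v \<in> braid_words n \<longleftrightarrow> u \<in> braid_words n \<and> v \<in> braid_words n"
  by (auto simp: braid_words_def)

lemma braid_words_Nil [simp]: "[] \<in> braid_words n"
  by (auto simp: braid_words_def)

lemma braid_words_Cons [simp]:
  "x # v \<in> braid_words n \<longleftrightarrow> fst x \<in> {1..<n} \<and> v \<in> braid_words n"
  by (cases x) (auto simp: braid_words_def)

lemma braid_equiv_words: "braid_equiv n u v \<Longrightarrow> u \<in> braid_words n \<and> v \<in> braid_words n"
  by (induction rule: braid_equiv.induct) auto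

lemma equiv_braid_rel: "equiv (braid_words n) (braid_rel n)"
proof (rule equivI)
  show "braid_rel n \<subseteq> braid_words n \<times> braid_words n"
    unfolding braid_rel_def by (blast dest: braid_equiv_words)
  show "refl_on (braid_words n) (braid_rel n)"
    by (rule refl_onI) (simp add: braid_rel_def braid_equiv.refl)
  show "sym_on UNIV (braid_rel n)"
    by (rule symI) (simp add: braid_rel_def braid_equiv.sym)
  show "trans_on UNIV (braid_rel n)"
    by (rule transI) (simp add: braid_rel_def, rule braid_equiv.trans)
qed

lemma braid_of_eq_iff:
  assumes "u \<in> braid_words n" "v \<in> braid_words n"
  shows "braid_of n u = braid_of n v \<longleftrightarrow> braid_equiv n u v"
  unfolding braid_of_def eq_equiv_class_iff[OF equiv_braid_rel assms] by (simp add: braid_rel_def)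

lemma mem_braid_of: "x \<in> braid_of n u \<longleftrightarrow> braid_equiv n u x"
  by (simp add: braid_of_def braid_rel_def)

lemma braid_of_in_carrier: "w \<in> braid_words n \<Longrightarrow> braid_of n w \<in> carrier (braid_group n)"
  by (auto simp: braid_group_def braid_of_def quotientI)

lemma carrier_braid_groupE:
  assumes "X \<in> carrier (braid_group n)"
  obtains w where "w \<in> braid_words n" "X = braid_of n w"
  using assms by (auto simp: braid_group_def braid_of_def elim: quotientE)

lemma braid_equiv_append:
  assumes "braid_equiv n u u'" "braid_equiv n v v'"
  shows "braid_equiv n (u @ v) (u' @ v')"
proof -
  note words = assms[THEN braid_equiv_words]
  have "braid_equiv n (u @ v) (u' @ v)"
    using braid_equiv.cong[OF assms(1), of "[]" v] words by simp
  moreover have "braid_equiv n (u' @ v) (u' @ v')"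
    using braid_equiv.cong[OF assms(2), of u' "[]"] words by simp
  ultimately show ?thesis by (rule braid_equiv.trans)
qed

lemma braid_of_mult:
  assumes "u \<in> braid_words n" "v \<in> braid_words n"
  shows "braid_of n u \<otimes>\<^bsub>braid_group n\<^esub> braid_of n v = braid_of n (u @ v)"
proof -
  have same: "braid_of n (x @ y) = braid_of n (u @ v)"
    if "x \<in> braid_of n u" "y \<in> braid_of n v" for x y
  proof -
    have eq: "braid_equiv n (u @ v) (x @ y)"
      using that unfolding mem_braid_of by (rule braid_equiv_append)
    show ?thesis
      using braid_of_eq_iff[THEN iffD2, OF _ _ eq] braid_equiv_words[OF eq] by simp
  qed
  have "u \<in> braid_of n u" "v \<in> braid_of n v"
    using assms by (simp_all add: mem_braid_of braid_equiv.refl)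
  then have "(\<Union>x\<in>braid_of n u. \<Union>y\<in>braid_of n v. braid_of n (x @ y)) = braid_of n (u @ v)"
    using same by blast
  then show ?thesis by (simp add: braid_group_def)
qed

lemma braid_inverse_word:
  "w \<in> braid_words n \<Longrightarrow> \<exists>w'\<in>braid_words n. braid_equiv n (w' @ w) []"
proof (induction w)
  case Nil
  show ?case by (rule bexI[of _ "[]"]) (auto intro: braid_equiv.refl)
next
  case (Cons x w)
  obtain i e where x: "x = (i, e)" by (cases x)
  have i: "i \<in> {1..<n}" and w: "w \<in> braid_words n" using Cons.prems x by auto
  obtain w' where w': "w' \<in> braid_words n" "braid_equiv n (w' @ w) []" using Cons.IH w by blast
  have "braid_equiv n (w' @ [(i, \<not> e), (i, e)] @ w) (w' @ [] @ w)"
    using braid_equiv.cong[OF braid_equiv.cancel[OF i, of "\<not> e"] w'(1) w] by simp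
  then have "braid_equiv n ((w' @ [(i, \<not> e)]) @ x # w) (w' @ w)"
    using x by simp
  then have "braid_equiv n ((w' @ [(i, \<not> e)]) @ x # w) []"
    using w'(2) by (rule braid_equiv.trans)
  then show ?case using w' i by (intro bexI[of _ "w' @ [(i, \<not> e)]"]) auto
qed

lemma group_braid_group: "group (braid_group n)"
proof (rule groupI)
  have one: "\<one>\<^bsub>braid_group n\<^esub> = braid_of n []" by (simp add: braid_group_def)
  show "\<one>\<^bsub>braid_group n\<^esub> \<in> carrier (braid_group n)" by (simp add: one braid_of_in_carrier)
  fix x assume "x \<in> carrier (braid_group n)"
  then obtain u where u: "u \<in> braid_words n" "x = braid_of n u" by (rule carrier_braid_groupE)
  show "\<one>\<^bsub>braid_group n\<^esub> \<otimes>\<^bsub>braid_group n\<^esub> x = x" using u by (simp add: one braid_of_mult)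
  show "\<exists>y\<in>carrier (braid_group n). y \<otimes>\<^bsub>braid_group n\<^esub> x = \<one>\<^bsub>braid_group n\<^esub>"
  proof -
    obtain u' where u': "u' \<in> braid_words n" "braid_equiv n (u' @ u) []"
      using braid_inverse_word u by blast
    then show ?thesis using u
      by (intro bexI[of _ "braid_of n u'"]) (auto simp: one braid_of_mult braid_of_eq_iff braid_of_in_carrier)
  qed
  fix y assume "y \<in> carrier (braid_group n)"
  then obtain v where v: "v \<in> braid_words n" "y = braid_of n v" by (rule carrier_braid_groupE)
  show "x \<otimes>\<^bsub>braid_group n\<^esub> y \<in> carrier (braid_group n)"
    using u v by (simp add: braid_of_mult braid_of_in_carrier)
  fix z assume "z \<in> carrier (braid_group n)"
  then obtain w where w: "w \<in> braid_words n" "z = braid_of n w" by (rule carrier_braid_groupE)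
  show "x \<otimes>\<^bsub>braid_group n\<^esub> y \<otimes>\<^bsub>braid_group n\<^esub> z = x \<otimes>\<^bsub>braid_group n\<^esub> (y \<otimes>\<^bsub>braid_group n\<^esub> z)"
    using u v w by (simp add: braid_of_mult)
qed

lemma word_perm_Nil [simp]: "word_perm [] = id"
  by (simp add: word_perm_def)

lemma word_perm_Cons [simp]: "word_perm (x # w) = Transposition.transpose (fst x) (fst x + 1) \<circ> word_perm w"
  by (cases x) (simp add: word_perm_def)

lemma word_perm_append: "word_perm (u @ v) = word_perm u \<circ> word_perm v"
  by (induction u) (auto simp: comp_assoc)

lemma word_perm_equiv: "braid_equiv n u v \<Longrightarrow> word_perm u = word_perm v"
proof (induction rule: braid_equiv.induct)
  case (far_comm i j)
  then show ?case by (auto simp: fun_eq_iff Transposition.transpose_def)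
next
  case (braid i)
  show ?case by (auto simp: fun_eq_iff Transposition.transpose_def)
qed (auto simp: word_perm_append)

lemma word_perm_permutes: "w \<in> braid_words n \<Longrightarrow> word_perm w permutes {1..n}"
proof (induction w)
  case Nil
  show ?case by (simp only: word_perm_Nil permutes_id)
next
  case (Cons x w)
  then have "Transposition.transpose (fst x) (fst x + 1) permutes {1..n}"
    by (intro permutes_swap_id) auto
  moreover have "word_perm w permutes {1..n}"
    using Cons by simp
  ultimately show ?case unfolding word_perm_Cons by (rule permutes_compose[rotated])
qed

lemma braid_perm_braid_of:
  assumes "w \<in> braid_words n"
  shows "braid_perm (braid_of n w) = word_perm w"
proof -
  have "word_perm ` braid_of n w = {word_perm w}"
  proof (intro equalityI subsetI)
    fix f assume "f \<in> word_perm ` braid_of n w"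
    then obtain v where v: "braid_equiv n w v" "f = word_perm v" by (auto simp: mem_braid_of)
    show "f \<in> {word_perm w}" using word_perm_equiv[OF v(1)] v(2) by simp
  next
    fix f assume "f \<in> {word_perm w}"
    then show "f \<in> word_perm ` braid_of n w"
      using braid_equiv.refl[OF assms] by (simp add: mem_braid_of)
  qed
  then show ?thesis by (simp add: braid_perm_def)
qed

lemma braid_perm_hom: "braid_perm \<in> hom (braid_group n) (sym_group n)"
proof (rule homI)
  fix X assume "X \<in> carrier (braid_group n)"
  then obtain u where u: "u \<in> braid_words n" "X = braid_of n u" by (rule carrier_braid_groupE)
  then show "braid_perm X \<in> carrier (sym_group n)"
    using word_perm_permutes[OF u(1)] braid_perm_braid_of[OF u(1)] by (simp only: sym_group_def) simp
  fix Y assume "Y \<in> carrier (braid_group n)"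
  then obtain v where v: "v \<in> braid_words n" "Y = braid_of n v" by (rule carrier_braid_groupE)
  show "braid_perm (X \<otimes>\<^bsub>braid_group n\<^esub> Y) = braid_perm X \<otimes>\<^bsub>sym_group n\<^esub> braid_perm Y"
    using u v by (simp add: braid_of_mult braid_perm_braid_of word_perm_append sym_group_def)
qed


section \<open>The subgroup \<open>\<Gamma>\<close>\<close>

definition pos_word :: "nat list \<Rightarrow> braid_word" where
  "pos_word is = map (\<lambda>i. (i, True)) is"

definition neg_word :: "nat list \<Rightarrow> braid_word" where
  "neg_word is = map (\<lambda>i. (i, False)) is"

definition A_gen :: "nat \<Rightarrow> nat \<Rightarrow> nat \<Rightarrow> braid_word set set" where
  "A_gen n i j = quotient_class n
     (pos_word (rev [i + 1..<j]) @ pos_word [i, i] @ neg_word [i + 1..<j])"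

text \<open>
  The two index ranges meet at \<open>(n + 1) / 2\<close>, for odd \<open>n\<close>: the positive letters run down from
  \<open>n - 1\<close> to \<open>(n + 1) / 2\<close>, the negative ones from \<open>(n - 1) / 2\<close> to \<open>1\<close>.
\<close>

definition delta0 :: "nat \<Rightarrow> braid_word set set" where
  "delta0 n = quotient_class n
     (pos_word (rev [(n + 1) div 2..<n]) @ neg_word (rev [1..<(n + 1) div 2]))"

text \<open>The parameter \<open>n\<close> is the prime power.\<close>

definition Gamma_set :: "nat \<Rightarrow> braid_word set set set" where
  "Gamma_set n = generate (braid_quotient n)
     (insert (A_gen n 1 2 \<otimes>\<^bsub>braid_quotient n\<^esub> delta0 n)
        {A_gen n a b [^]\<^bsub>braid_quotient n\<^esub> n | a b. 1 \<le> a \<and> a < b \<and> b \<le> n})"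

definition Gamma_group :: "nat \<Rightarrow> braid_word set set monoid" where
  "Gamma_group n = braid_quotient n \<lparr> carrier := Gamma_set n \<rparr>"


section \<open>Bieberbach groups and flat manifolds\<close>

definition isometry_group :: "('e::euclidean_space \<Rightarrow> 'e) monoid" where
  "isometry_group = \<lparr> carrier = {f. bij f \<and> (\<forall>x y. dist (f x) (f y) = dist x y)},
                      mult = (\<circ>), one = id \<rparr>"

definition orbit_map :: "('e \<Rightarrow> 'e) set \<Rightarrow> 'e \<Rightarrow> 'e set" where
  "orbit_map G x = (\<lambda>f. f x) ` G"

definition orbit_space :: "('e::euclidean_space \<Rightarrow> 'e) set \<Rightarrow> 'e set topology" where
  "orbit_space G = topology (\<lambda>U. U \<subseteq> range (orbit_map G) \<and> open (orbit_map G -` U))"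

lemma openin_orbit_space:
  "openin (orbit_space G) U \<longleftrightarrow> U \<subseteq> range (orbit_map G) \<and> open (orbit_map G -` U)"
proof -
  have "istopology (\<lambda>U. U \<subseteq> range (orbit_map G) \<and> open (orbit_map G -` U))"
    unfolding istopology_def by (auto simp: vimage_Union open_Int)
  then show ?thesis by (simp add: orbit_space_def)
qed

lemma topspace_orbit_space: "topspace (orbit_space G) = range (orbit_map G)"
proof -
  have "orbit_map G -` range (orbit_map G) = UNIV" by auto
  then have "openin (orbit_space G) (range (orbit_map G))"
    by (simp add: openin_orbit_space)
  then show ?thesis by (auto simp: topspace_def openin_orbit_space)
qed

lemma quotient_map_orbit_map: "quotient_map euclidean (orbit_space G) (orbit_map G)"
  by (auto simp: quotient_map_def topspace_orbit_space openin_orbit_space vimage_def)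

text \<open>
  Discreteness refers to the topology of pointwise convergence (the library topology on functions),
  which on isometries is the usual topology of \<open>\<real>\<^sup>N \<rtimes> O(N)\<close>.
\<close>

definition crystallographic_group :: "('e::euclidean_space \<Rightarrow> 'e) set \<Rightarrow> bool" where
  "crystallographic_group G \<longleftrightarrow>
     subgroup G isometry_group \<and> discrete G \<and> compact_space (orbit_space G)"

definition bieberbach_group :: "('e::euclidean_space \<Rightarrow> 'e) set \<Rightarrow> bool" where
  "bieberbach_group G \<longleftrightarrow>
     crystallographic_group G \<and> (\<forall>f\<in>G. \<forall>k\<ge>1. f ^^ k = id \<longrightarrow> f = id)"


section \<open>Smooth manifolds\<close>

primrec differentiable_upto ::
  "nat \<Rightarrow> 'e::euclidean_space set \<Rightarrow> ('e \<Rightarrow> 'f::real_normed_vector) \<Rightarrow> bool" where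
  "differentiable_upto 0 S f \<longleftrightarrow> continuous_on S f"
| "differentiable_upto (Suc k) S f \<longleftrightarrow> (\<forall>x\<in>S. f differentiable (at x)) \<and>
     (\<forall>v. differentiable_upto k S (\<lambda>x. frechet_derivative f (at x) v))"

text \<open>Infinitely often differentiable; only used for open \<open>S\<close>.\<close>

definition smooth_on :: "'e::euclidean_space set \<Rightarrow> ('e \<Rightarrow> 'f::real_normed_vector) \<Rightarrow> bool" where
  "smooth_on S f \<longleftrightarrow> (\<forall>k. differentiable_upto k S f)"

text \<open>A chart is a pair of its domain and its coordinate map.\<close>

type_synonym ('x, 'e) chart = "'x set \<times> ('x \<Rightarrow> 'e)"

abbreviation chart_image :: "('x, 'e) chart \<Rightarrow> 'e set" where
  "chart_image c \<equiv> snd c ` fst c"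

definition is_chart :: "'x topology \<Rightarrow> ('x, 'e::euclidean_space) chart \<Rightarrow> bool" where
  "is_chart T c \<longleftrightarrow> openin T (fst c) \<and> open (chart_image c) \<and>
     homeomorphic_map (subtopology T (fst c)) (top_of_set (chart_image c)) (snd c)"

definition transition :: "('x, 'e) chart \<Rightarrow> ('x, 'e) chart \<Rightarrow> 'e \<Rightarrow> 'e" where
  "transition c d = snd d \<circ> inv_into (fst c) (snd c)"

definition overlap :: "('x, 'e) chart \<Rightarrow> ('x, 'e) chart \<Rightarrow> 'e set" where
  "overlap c d = snd c ` (fst c \<inter> fst d)"

abbreviation transition_deriv ::
  "('x, 'e::euclidean_space) chart \<Rightarrow> ('x, 'e) chart \<Rightarrow> 'e \<Rightarrow> 'e \<Rightarrow> 'e" where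
  "transition_deriv c d y \<equiv> frechet_derivative (transition c d) (at y)"

definition smooth_manifold :: "'x topology \<Rightarrow> ('x, 'e::euclidean_space) chart set \<Rightarrow> bool" where
  "smooth_manifold T \<A> \<longleftrightarrow>
     Hausdorff_space T \<and> second_countable T \<and>
     (\<forall>c\<in>\<A>. is_chart T c) \<and> topspace T = (\<Union>c\<in>\<A>. fst c) \<and>
     (\<forall>c\<in>\<A>. \<forall>d\<in>\<A>. smooth_on (overlap c d) (transition c d))"

text \<open>
  The closed flat manifold with fundamental group a Bieberbach group \<open>G\<close> is the orbit space of the
  free, properly discontinuous action of \<open>G\<close> by isometries of Euclidean space.  Its charts are the
  local inverses of the covering projection, defined on the images of the open sets on which the
  projection is injective.
\<close>

definition orbit_charts ::
  "('e::euclidean_space \<Rightarrow> 'e) set \<Rightarrow> ('e set, 'e) chart set" where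
  "orbit_charts G =
     {(orbit_map G ` V, inv_into V (orbit_map G)) | V. open V \<and> inj_on (orbit_map G) V}"


section \<open>Kaehler manifolds\<close>

text \<open>
  Tensor fields are given by their components in each chart, subject to the transformation law under
  changes of coordinates: \<open>g c y u v\<close> is the value at the point with coordinates \<open>y\<close> in the chart \<open>c\<close>
  on the tangent vectors with coordinates \<open>u\<close> and \<open>v\<close>.
\<close>

definition covariant_2_tensor ::
  "('x, 'e::euclidean_space) chart set \<Rightarrow> (('x, 'e) chart \<Rightarrow> 'e \<Rightarrow> 'e \<Rightarrow> 'e \<Rightarrow> real) \<Rightarrow> bool" where
  "covariant_2_tensor \<A> t \<longleftrightarrow>
     (\<forall>c\<in>\<A>. \<forall>y\<in>chart_image c. bilinear (t c y)) \<and>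
     (\<forall>c\<in>\<A>. \<forall>u v. smooth_on (chart_image c) (\<lambda>y. t c y u v)) \<and>
     (\<forall>c\<in>\<A>. \<forall>d\<in>\<A>. \<forall>y\<in>overlap c d. \<forall>u v.
        t c y u v = t d (transition c d y) (transition_deriv c d y u) (transition_deriv c d y v))"

definition endomorphism_field ::
  "('x, 'e::euclidean_space) chart set \<Rightarrow> (('x, 'e) chart \<Rightarrow> 'e \<Rightarrow> 'e \<Rightarrow> 'e) \<Rightarrow> bool" where
  "endomorphism_field \<A> J \<longleftrightarrow>
     (\<forall>c\<in>\<A>. \<forall>y\<in>chart_image c. linear (J c y)) \<and>
     (\<forall>c\<in>\<A>. \<forall>u. smooth_on (chart_image c) (\<lambda>y. J c y u)) \<and>
     (\<forall>c\<in>\<A>. \<forall>d\<in>\<A>. \<forall>y\<in>overlap c d. \<forall>u.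
        transition_deriv c d y (J c y u) = J d (transition c d y) (transition_deriv c d y u))"

definition riemannian_metric ::
  "('x, 'e::euclidean_space) chart set \<Rightarrow> (('x, 'e) chart \<Rightarrow> 'e \<Rightarrow> 'e \<Rightarrow> 'e \<Rightarrow> real) \<Rightarrow> bool" where
  "riemannian_metric \<A> g \<longleftrightarrow> covariant_2_tensor \<A> g \<and>
     (\<forall>c\<in>\<A>. \<forall>y\<in>chart_image c.
        (\<forall>u v. g c y u v = g c y v u) \<and> (\<forall>u. u \<noteq> 0 \<longrightarrow> g c y u u > 0))"

text \<open>
  The closedness condition is the vanishing of the exterior derivative of \<open>\<omega>\<close> evaluated on constant
  vector fields \<open>u\<close>, \<open>v\<close>, \<open>w\<close>.
\<close>

definition symplectic_structure ::
  "('x, 'e::euclidean_space) chart set \<Rightarrow> (('x, 'e) chart \<Rightarrow> 'e \<Rightarrow> 'e \<Rightarrow> 'e \<Rightarrow> real) \<Rightarrow> bool" where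
  "symplectic_structure \<A> \<omega> \<longleftrightarrow> covariant_2_tensor \<A> \<omega> \<and>
     (\<forall>c\<in>\<A>. \<forall>y\<in>chart_image c.
        (\<forall>u v. \<omega> c y u v = - \<omega> c y v u) \<and>
        (\<forall>u. (\<forall>v. \<omega> c y u v = 0) \<longrightarrow> u = 0) \<and>
        (\<forall>u v w. frechet_derivative (\<lambda>z. \<omega> c z v w) (at y) u
               + frechet_derivative (\<lambda>z. \<omega> c z w u) (at y) v
               + frechet_derivative (\<lambda>z. \<omega> c z u v) (at y) w = 0))"

text \<open>
  Integrability is the existence of holomorphic coordinates: around every point there are smooth
  coordinates \<open>h\<close> (with smooth inverse \<open>k\<close>) in which the almost complex structure is constant.
\<close>

definition complex_structure ::
  "('x, 'e::euclidean_space) chart set \<Rightarrow> (('x, 'e) chart \<Rightarrow> 'e \<Rightarrow> 'e \<Rightarrow> 'e) \<Rightarrow> bool" where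
  "complex_structure \<A> J \<longleftrightarrow> endomorphism_field \<A> J \<and>
     (\<forall>c\<in>\<A>. \<forall>y\<in>chart_image c. \<forall>u. J c y (J c y u) = - u) \<and>
     (\<forall>c\<in>\<A>. \<forall>y\<in>chart_image c. \<exists>W (h :: 'e \<Rightarrow> 'e) k J0.
        open W \<and> y \<in> W \<and> W \<subseteq> chart_image c \<and> open (h ` W) \<and>
        smooth_on W h \<and> smooth_on (h ` W) k \<and> (\<forall>z\<in>W. k (h z) = z) \<and> linear J0 \<and>
        (\<forall>z\<in>W. \<forall>u. frechet_derivative h (at z) (J c z u) = J0 (frechet_derivative h (at z) u)))"

text \<open>That the real dimension is even is forced by the existence of \<open>J\<close>, hence not repeated.\<close>

definition kaehler_manifold :: "'x topology \<Rightarrow> ('x, 'e::euclidean_space) chart set \<Rightarrow> bool" where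
  "kaehler_manifold T \<A> \<longleftrightarrow> smooth_manifold T \<A> \<and>
     (\<exists>g J \<omega>. riemannian_metric \<A> g \<and> complex_structure \<A> J \<and> symplectic_structure \<A> \<omega> \<and>
        (\<forall>c\<in>\<A>. \<forall>y\<in>chart_image c. \<forall>u v.
           g c y (J c y u) (J c y v) = g c y u v \<and> \<omega> c y u v = g c y (J c y u) v))"

end

(*
If the quotient is Kaehler, a linear map with J^2 = -1 exists on a tangent space, so n (n - 1) / 2 is
even; as n is odd this forces n = 1 mod 4.

Conversely, conjugation in B_n / [P_n, P_n] permutes the classes A_ij through the symmetric group, and
the generator x = A_12 delta of Gamma acts on them by the n-cycle i |-> i - 1.  Modulo the A_ij the
element x is a Coxeter element, so x^n lies in the subgroup they generate and the A_ij^n generate an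
abelian normal subgroup of finite index in Gamma.  In the given Bieberbach group this subgroup is still
cocompact, hence consists of translations (displacements are bounded), and its n (n - 1) / 2 generators
span the space; by the dimension they form a basis.  The linear part R of x permutes this basis in
(n - 1) / 2 orbits of length n.  If n = 4 u + 1 the orbits can be paired, which gives K with K^2 = -1
commuting with R, and constant tensors built from K descend to a Kaehler structure.
*)
theory Submission
  imports Defs "HOL-Algebra.Zassenhaus"
begin

section \<open>Conjugation on the pure braid classes\<close>

text \<open>Pure classes commute, so conjugation by a braid word depends only on its permutation.
  The mixed signs in \<open>delta0\<close> therefore affect neither the action on the A_ij nor the
  class modulo them, and x can be treated like the plain descending product sigma_{n-1} ... sigma_1.
  Only the powers A_ij^n are generators of Gamma, so the relation for x^n has to be raised to the
  n-th power once more: x^(n^2) lies in the subgroup generated by the A_ij^n. The isomorphism with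
  the given Bieberbach group carries abstract group data only; that the A_ij^n act by translations,
  that these span, and that the action is free are recovered from discreteness, cocompactness and
  torsion-freeness. The orbits of i |-> i - 1 on pairs {i,j} are indexed by the cyclic distance,
  which for odd n takes the values 1, ..., (n - 1)/2. The linear part thus acts as (n - 1)/2 copies
  of the regular representation of Z_n, and K exchanges two copies up to a sign. The basis need not
  be orthonormal, so K need not be orthogonal; this forces a change of the inner product.\<close>

text \<open>This is P_n/[P_n,P_n], described through words so that membership can be checked by
  evaluating \<open>word_perm\<close>.\<close>

definition pure_classes :: "nat \<Rightarrow> braid_word set set set" where
  "pure_classes n = quotient_class n ` {w \<in> braid_words n. word_perm w = id}"

definition conj_by :: "nat \<Rightarrow> braid_word \<Rightarrow> braid_word set set \<Rightarrow> braid_word set set" where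
  "conj_by n w a = quotient_class n w \<otimes>\<^bsub>braid_quotient n\<^esub> a
     \<otimes>\<^bsub>braid_quotient n\<^esub> inv\<^bsub>braid_quotient n\<^esub> quotient_class n w"

context
  fixes n :: nat
begin

interpretation B: group "braid_group n"
  by (rule group_braid_group)

lemma pure_braid_group_normal: "pure_braid_group n \<lhd> braid_group n"
proof -
  interpret group_hom "braid_group n" "sym_group n" braid_perm
    by (intro group_hom.intro group_hom_axioms.intro group_braid_group sym_group_is_group braid_perm_hom)
  show ?thesis
    unfolding pure_braid_group_def by (rule normal_kernel)
qed

lemma pure_commutator_normal: "pure_commutator n \<lhd> braid_group n"
  unfolding pure_commutator_def by (rule B.derived_is_normal[OF pure_braid_group_normal])

interpretation N: normal "pure_commutator n" "braid_group n"
  by (rule pure_commutator_normal)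

lemma group_braid_quotient: "group (braid_quotient n)"
  unfolding braid_quotient_def by (rule N.factorgroup_is_group)

interpretation Q: group "braid_quotient n"
  by (rule group_braid_quotient)

lemma quotient_class_closed [simp]:
  "w \<in> braid_words n \<Longrightarrow> quotient_class n w \<in> carrier (braid_quotient n)"
  by (auto simp: quotient_class_def braid_quotient_def FactGroup_def RCOSETS_def braid_of_in_carrier)

lemma quotient_class_append:
  assumes "u \<in> braid_words n" "v \<in> braid_words n"
  shows "quotient_class n (u @ v) = quotient_class n u \<otimes>\<^bsub>braid_quotient n\<^esub> quotient_class n v"
  using assms
  by (simp add: quotient_class_def braid_quotient_def N.rcos_sum braid_of_in_carrier braid_of_mult)

lemma quotient_class_Nil: "quotient_class n [] = \<one>\<^bsub>braid_quotient n\<^esub>"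
proof -
  have "braid_of n [] = \<one>\<^bsub>braid_group n\<^esub>"
    by (simp add: braid_group_def)
  then show ?thesis
    by (simp add: quotient_class_def braid_quotient_def N.subset B.coset_mult_one)
qed

lemma quotient_class_cong:
  "braid_equiv n u v \<Longrightarrow> quotient_class n u = quotient_class n v"
  using braid_of_eq_iff[of u n v] braid_equiv_words[of n u v] by (simp add: quotient_class_def)

lemma carrier_braid_quotientE:
  assumes "a \<in> carrier (braid_quotient n)"
  obtains w where "w \<in> braid_words n" "a = quotient_class n w"
proof -
  from assms obtain X where X: "X \<in> carrier (braid_group n)" "a = pure_commutator n #>\<^bsub>braid_group n\<^esub> X"
    by (auto simp: braid_quotient_def FactGroup_def RCOSETS_def)
  from X(1) obtain w where "w \<in> braid_words n" "X = braid_of n w"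
    by (rule carrier_braid_groupE)
  with X that show ?thesis by (auto simp: quotient_class_def)
qed

lemma quotient_class_inverse:
  assumes "w \<in> braid_words n"
  obtains w' where "w' \<in> braid_words n" "word_perm w \<circ> word_perm w' = id"
    "quotient_class n w' = inv\<^bsub>braid_quotient n\<^esub> quotient_class n w"
proof -
  obtain w' where w': "w' \<in> braid_words n" "braid_equiv n (w' @ w) []"
    using braid_inverse_word[OF assms] by blast
  have "quotient_class n w' \<otimes>\<^bsub>braid_quotient n\<^esub> quotient_class n w = \<one>\<^bsub>braid_quotient n\<^esub>"
    using quotient_class_cong[OF w'(2)] w'(1) assms
    by (simp add: quotient_class_append quotient_class_Nil)
  then have "quotient_class n w' = inv\<^bsub>braid_quotient n\<^esub> quotient_class n w"
    using w'(1) assms by (intro Q.inv_equality[symmetric]) auto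
  moreover have "word_perm w' \<circ> word_perm w = id"
    using word_perm_equiv[OF w'(2)] by (simp add: word_perm_append)
  then have "word_perm w \<circ> word_perm w' = id"
    using word_perm_permutes[OF assms] by (metis bij_betw_def inv_unique_comp o_inv_distrib permutes_bij surj_iff permutes_surj comp_assoc id_comp comp_id)
  ultimately show ?thesis using that w'(1) by blast
qed

lemma pure_classesI: "w \<in> braid_words n \<Longrightarrow> word_perm w = id \<Longrightarrow> quotient_class n w \<in> pure_classes n"
  by (auto simp: pure_classes_def)

lemma pure_classes_closed: "a \<in> pure_classes n \<Longrightarrow> a \<in> carrier (braid_quotient n)"
  by (auto simp: pure_classes_def)

text \<open>For pure representatives, xy = [x,y] yx with [x,y] in \<open>pure_commutator\<close>, so
  xy and yx lie in the same coset.\<close>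

lemma pure_classes_commute:
  assumes "a \<in> pure_classes n" "b \<in> pure_classes n"
  shows "a \<otimes>\<^bsub>braid_quotient n\<^esub> b = b \<otimes>\<^bsub>braid_quotient n\<^esub> a"
proof -
  obtain u v where u: "u \<in> braid_words n" "word_perm u = id" "a = quotient_class n u"
    and v: "v \<in> braid_words n" "word_perm v = id" "b = quotient_class n v"
    using assms by (auto simp: pure_classes_def)
  define x y where "x = braid_of n u" and "y = braid_of n v"
  have xy: "x \<in> pure_braid_group n" "y \<in> pure_braid_group n"
    using u v by (auto simp: x_def y_def pure_braid_group_def kernel_def braid_of_in_carrier
        braid_perm_braid_of sym_group_def)
  have c: "x \<in> carrier (braid_group n)" "y \<in> carrier (braid_group n)"
    using u v by (auto simp: x_def y_def braid_of_in_carrier)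
  let ?m = "\<lambda>a b. a \<otimes>\<^bsub>braid_group n\<^esub> b"
  let ?k = "?m (?m (?m x y) (inv\<^bsub>braid_group n\<^esub> x)) (inv\<^bsub>braid_group n\<^esub> y)"
  have "?k \<in> pure_commutator n"
    unfolding pure_commutator_def derived_def using xy by (intro generate.incl) blast
  moreover have "?m x y = ?m ?k (?m y x)"
    using c by (simp add: B.m_assoc) (simp add: B.m_assoc[symmetric])
  ultimately have "?m x y \<in> pure_commutator n #>\<^bsub>braid_group n\<^esub> ?m y x"
    by (auto simp: r_coset_def)
  then have "pure_commutator n #>\<^bsub>braid_group n\<^esub> ?m x y = pure_commutator n #>\<^bsub>braid_group n\<^esub> ?m y x"
    using B.repr_independence[OF _ _ N.subgroup_axioms] c by auto
  then show ?thesis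
    using u v c by (simp add: quotient_class_def braid_quotient_def N.rcos_sum x_def y_def)
qed

lemma conj_by_append:
  assumes "u \<in> braid_words n" "v \<in> braid_words n" "a \<in> carrier (braid_quotient n)"
  shows "conj_by n (u @ v) a = conj_by n u (conj_by n v a)"
  using assms by (simp add: conj_by_def quotient_class_append Q.inv_mult_group Q.m_assoc)

lemma conj_by_Cons:
  assumes "i \<in> {1..<n}" "v \<in> braid_words n" "a \<in> carrier (braid_quotient n)"
  shows "conj_by n ((i, e) # v) a = conj_by n [(i, e)] (conj_by n v a)"
  using conj_by_append[of "[(i, e)]" v a] assms by simp

lemma conj_by_pure [simp]:
  assumes "w \<in> braid_words n" "a \<in> pure_classes n"
  shows "conj_by n w a \<in> pure_classes n"
proof -
  obtain u where u: "u \<in> braid_words n" "word_perm u = id" "a = quotient_class n u"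
    using assms by (auto simp: pure_classes_def)
  obtain w' where w': "w' \<in> braid_words n" "word_perm w \<circ> word_perm w' = id"
    "quotient_class n w' = inv\<^bsub>braid_quotient n\<^esub> quotient_class n w"
    using quotient_class_inverse[OF assms(1)] .
  have "conj_by n w a = quotient_class n (w @ u @ w')"
    using u assms(1) w' by (simp add: conj_by_def quotient_class_append Q.m_assoc)
  then show ?thesis
    using u w' assms(1) by (auto intro!: pure_classesI simp: word_perm_append)
qed

text \<open>Commutativity of the pure classes; this is what makes the conjugation action factor
  through the symmetric group.\<close>

lemma conj_by_pure_trivial:
  assumes "w \<in> braid_words n" "word_perm w = id" "a \<in> pure_classes n"
  shows "conj_by n w a = a"
  using pure_classes_commute[OF pure_classesI[OF assms(1,2)] assms(3)]
    pure_classes_closed[OF assms(3)] assms(1)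
  by (simp add: conj_by_def Q.m_assoc)

text \<open>Conjugation is read off from an identity wu = vw of positive words, which avoids inverse
  letters in the braid computations below.\<close>

lemma conj_by_quotient_class:
  assumes "w \<in> braid_words n" "u \<in> braid_words n" "v \<in> braid_words n"
    and "braid_equiv n (w @ u) (v @ w)"
  shows "conj_by n w (quotient_class n u) = quotient_class n v"
  using quotient_class_cong[OF assms(4)] assms(1-3)
  by (simp add: conj_by_def quotient_class_append Q.m_assoc)

lemma conj_by_cong:
  assumes "braid_equiv n u v"
  shows "conj_by n u a = conj_by n v a"
  using quotient_class_cong[OF assms] by (simp add: conj_by_def)

end

section \<open>Action of the braid generators on the classes A_ij\<close>

definition A_sym :: "nat \<Rightarrow> nat \<Rightarrow> nat \<Rightarrow> braid_word set set" where
  "A_sym n i j = A_gen n (min i j) (max i j)"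

context
  fixes n :: nat
begin

interpretation Q: group "braid_quotient n"
  by (rule group_braid_quotient)

text \<open>Two letters with the same index form a word with trivial permutation, whatever their
  signs, so together they act trivially.\<close>

lemma conj_gen_conj_gen:
  assumes "k \<in> {1..<n}" "a \<in> pure_classes n"
  shows "conj_by n [(k, d)] (conj_by n [(k, e)] a) = a"
  using conj_by_append[of "[(k, d)]" n "[(k, e)]" a] conj_by_pure_trivial[of "[(k, d), (k, e)]" n a]
    pure_classes_closed[of a n] assms by simp

lemma conj_gen_sign:
  assumes "k \<in> {1..<n}" "a \<in> pure_classes n"
  shows "conj_by n [(k, e)] a = conj_by n [(k, True)] a"
  using conj_gen_conj_gen[OF assms(1), of "conj_by n [(k, True)] a" e True] conj_gen_conj_gen[OF assms]
    assms by simp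

lemma conj_gen_far:
  assumes "k \<in> {1..<n}" "l \<in> {1..<n}" "k + 2 \<le> l \<or> l + 2 \<le> k" "a \<in> pure_classes n"
  shows "conj_by n [(k, True)] (conj_by n [(l, True)] a) = conj_by n [(l, True)] (conj_by n [(k, True)] a)"
  using conj_by_append[of "[(k, True)]" n "[(l, True)]" a] conj_by_append[of "[(l, True)]" n "[(k, True)]" a]
    conj_by_cong[OF braid_equiv.far_comm[of k n l]] conj_by_cong[OF braid_equiv.far_comm[of l n k]]
    pure_classes_closed[of a n] assms by auto

lemma conj_gen_braid:
  assumes "k \<in> {1..<n}" "Suc k \<in> {1..<n}" "a \<in> pure_classes n"
  shows "conj_by n [(k, True)] (conj_by n [(Suc k, True)] (conj_by n [(k, True)] a))
       = conj_by n [(Suc k, True)] (conj_by n [(k, True)] (conj_by n [(Suc k, True)] a))"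
proof -
  have "conj_by n [(k, True), (Suc k, True), (k, True)] a
      = conj_by n [(Suc k, True), (k, True), (Suc k, True)] a"
    using conj_by_cong[OF braid_equiv.braid[of k n]] assms by simp
  then show ?thesis
    using assms pure_classes_closed[of a n]
    by (simp add: conj_by_Cons[of _ n "[_, _]"] conj_by_Cons[of _ n "[_]"])
qed

lemma A_gen_adjacent: "A_gen n i (Suc i) = quotient_class n [(i, True), (i, True)]"
  by (simp add: A_gen_def pos_word_def neg_word_def)

text \<open>The recursion on the larger index that drives the inductions over A_ij: passing from j
  to j + 1 wraps the word in one more pair of letters.\<close>

lemma A_gen_Suc:
  assumes "1 \<le> i" "i < j" "j < n"
  shows "A_gen n i (Suc j) = conj_by n [(j, True)] (A_gen n i j)"
proof -
  have inv: "quotient_class n [(j, False)] = inv\<^bsub>braid_quotient n\<^esub> quotient_class n [(j, True)]"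
  proof (rule Q.inv_equality[symmetric])
    show "quotient_class n [(j, False)] \<otimes>\<^bsub>braid_quotient n\<^esub> quotient_class n [(j, True)] = \<one>\<^bsub>braid_quotient n\<^esub>"
      using quotient_class_append[of "[(j, False)]" n "[(j, True)]"]
        quotient_class_cong[OF braid_equiv.cancel[of j n False]] assms quotient_class_Nil[of n] by simp
  qed (use assms in auto)
  let ?w = "pos_word (rev [i + 1..<j]) @ pos_word [i, i] @ neg_word [i + 1..<j]"
  have w: "?w \<in> braid_words n"
    using assms by (auto simp: pos_word_def neg_word_def braid_words_def)
  have "pos_word (rev [i + 1..<Suc j]) @ pos_word [i, i] @ neg_word [i + 1..<Suc j]
      = [(j, True)] @ ?w @ [(j, False)]"
    using assms by (simp add: pos_word_def neg_word_def)
  then have "A_gen n i (Suc j) = quotient_class n ([(j, True)] @ ?w @ [(j, False)])"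
    by (simp only: A_gen_def)
  also have "\<dots> = quotient_class n [(j, True)] \<otimes>\<^bsub>braid_quotient n\<^esub> (quotient_class n ?w \<otimes>\<^bsub>braid_quotient n\<^esub> quotient_class n [(j, False)])"
    using w assms by (subst quotient_class_append, simp, simp)+ simp
  finally show ?thesis
    using w assms by (simp add: conj_by_def A_gen_def inv Q.m_assoc del: braid_words_append)
qed

lemma A_gen_pure:
  assumes "1 \<le> i" "i < j" "j \<le> n"
  shows "A_gen n i j \<in> pure_classes n"
  using Suc_leI[OF assms(2)] assms(3)
proof (induction j rule: dec_induct)
  case base
  then show ?case
    using assms by (auto simp: A_gen_adjacent intro!: pure_classesI)
next
  case (step j)
  then show ?case
    using assms(1) by (simp add: A_gen_Suc)
qed

lemma conj_gen_A_adjacent: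
  assumes "1 \<le> i" "i < n" "k \<in> {1..<n}" "k = i \<or> k + 2 \<le> i \<or> i + 2 \<le> k"
  shows "conj_by n [(k, True)] (A_gen n i (Suc i)) = A_gen n i (Suc i)"
  unfolding A_gen_adjacent
proof (rule conj_by_quotient_class)
  let ?k = "(k, True)" and ?i = "(i, True)"
  have "braid_equiv n [?k, ?i] [?i, ?k]"
    using assms braid_equiv.far_comm[of k n i] braid_equiv.sym[OF braid_equiv.far_comm[of i n k]]
      braid_equiv.refl[of "[?k, ?k]" n] by auto
  from braid_equiv.cong[OF this, of "[]" "[?i]"] braid_equiv.cong[OF this, of "[?i]" "[]"]
  have "braid_equiv n [?k, ?i, ?i] [?i, ?k, ?i]" "braid_equiv n [?i, ?k, ?i] [?i, ?i, ?k]"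
    using assms by simp_all
  then show "braid_equiv n ([?k] @ [?i, ?i]) ([?i, ?i] @ [?k])"
    using braid_equiv.trans by simp
qed (use assms in auto)

text \<open>Two applications of the braid relation turn sigma_i sigma_{i+1} sigma_i^2 into
  sigma_{i+1}^2 sigma_i sigma_{i+1}; the inner conjugation by sigma_{i+1} produces A_{i,i+2} from
  A_{i,i+1}.\<close>

lemma conj_gen_A_shift:
  assumes "1 \<le> i" "Suc i < n"
  shows "conj_by n [(i, True)] (A_gen n i (Suc (Suc i))) = A_gen n (Suc i) (Suc (Suc i))"
proof -
  let ?i = "(i, True)" and ?j = "(Suc i, True)"
  have e: "braid_equiv n [?i, ?j, ?i] [?j, ?i, ?j]"
    using assms braid_equiv.braid[of i n] by simp
  from braid_equiv.cong[OF this, of "[]" "[?i]"] braid_equiv.cong[OF this, of "[?j]" "[]"]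
  have "braid_equiv n ([?i, ?j] @ [?i, ?i]) ([?j, ?j] @ [?i, ?j])"
    using assms by (auto intro: braid_equiv.trans)
  then have "conj_by n [?i, ?j] (A_gen n i (Suc i)) = A_gen n (Suc i) (Suc (Suc i))"
    unfolding A_gen_adjacent using assms by (intro conj_by_quotient_class) auto
  then show ?thesis
    using assms A_gen_pure[of i "Suc i"] pure_classes_closed[of _ n]
    by (simp add: A_gen_Suc conj_by_Cons[of _ n "[_]"])
qed

text \<open>Strong induction on j. For j = l + 1 > i + 1 the outer conjugation by sigma_l is peeled
  off, and sigma_k either commutes with it, cancels it, extends it, or meets it in a braid relation.
  The result may have its indices in reversed order, hence \<open>A_sym\<close> on the
  right.\<close>

lemma conj_gen_A_gen:
  assumes "1 \<le> i" "i < j" "j \<le> n" "k \<in> {1..<n}"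
  shows "conj_by n [(k, True)] (A_gen n i j)
       = A_sym n (Transposition.transpose k (Suc k) i) (Transposition.transpose k (Suc k) j)"
  using assms(2-4)
proof (induction j arbitrary: k rule: less_induct)
  case (less j)
  let ?T = "\<lambda>k. conj_by n [(k, True)]" and ?t = "\<lambda>k. Transposition.transpose k (Suc k)"
  show ?case
  proof (cases "j = Suc i")
    case True
    consider "k = i \<or> k + 2 \<le> i \<or> i + 2 \<le> k" | "k = Suc i" | "Suc k = i" by linarith
    then show ?thesis
    proof cases
      case 1
      then show ?thesis
        using less.prems assms(1) True
        by (auto simp: conj_gen_A_adjacent A_sym_def Transposition.transpose_def)
    next
      case 2
      then show ?thesis
        using less.prems assms(1) True A_gen_Suc[of i "Suc i"]
        by (auto simp: A_sym_def Transposition.transpose_def)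
    next
      case 3
      then show ?thesis
        using less.prems assms(1) True conj_gen_A_shift[of k] conj_gen_conj_gen[of k "A_gen n k (Suc (Suc k))" True True]
          A_gen_pure[of k "Suc (Suc k)"]
        by (auto simp: A_sym_def Transposition.transpose_def)
    qed
  next
    case False
    with less.prems obtain l where l: "j = Suc l" "i < l" "l < n" by (cases j) auto
    have A: "A_gen n i j = ?T l (A_gen n i l)" "A_gen n i l \<in> pure_classes n"
      using l assms(1) by (simp_all add: A_gen_Suc A_gen_pure)
    note IH = less.IH[of l]
    consider "k = l" | "k = j" | "Suc k = l" "i < k" | "Suc k = l" "i = k" | "k + 2 \<le> l" | "l + 2 \<le> k"
      using l less.prems by linarith
    then show ?thesis
    proof cases
      case 1
      then show ?thesis
        using l A less.prems conj_gen_conj_gen[of k "A_gen n i l" True True]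
        by (auto simp: A_sym_def Transposition.transpose_def)
    next
      case 2
      then show ?thesis
        using l A less.prems assms(1) A_gen_Suc[of i j] by (auto simp: A_sym_def Transposition.transpose_def)
    next
      case 3
      have B: "A_gen n i l = ?T k (A_gen n i k)" "A_gen n i k \<in> pure_classes n"
        using 3 l assms(1) A_gen_Suc[of i k] by (auto intro: A_gen_pure)
      \<comment> \<open>Both indices moved by sigma_l exceed k. After the braid relation the
        innermost sigma_l thus acts trivially, and sigma_l sigma_k rebuilds A_ij from A_ik.\<close>
      have fixed: "?T l (A_gen n i k) = A_gen n i k"
        using less.IH[of k l] 3 l by (auto simp: A_sym_def Transposition.transpose_def)
      have "?T k (A_gen n i j) = ?T k (?T l (?T k (A_gen n i k)))"
        using A B by simp
      also have "\<dots> = ?T l (?T k (?T l (A_gen n i k)))"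
        using conj_gen_braid[of k "A_gen n i k"] B 3 l less.prems by simp
      finally show ?thesis
        using fixed A B 3 l by (auto simp: A_sym_def Transposition.transpose_def)
    next
      case 4
      then show ?thesis
        using conj_gen_A_shift[of i] l assms(1) by (auto simp: A_sym_def Transposition.transpose_def)
    next
      case 5
      have "?T k (A_gen n i j) = ?T l (?T k (A_gen n i l))"
        using A conj_gen_far[of k l "A_gen n i l"] 5 l less.prems by simp
      also have "?T k (A_gen n i l) = A_gen n (?t k i) l"
        using IH[of k] 5 l less.prems by (auto simp: A_sym_def Transposition.transpose_def)
      also have "?T l (A_gen n (?t k i) l) = A_gen n (?t k i) j"
        using A_gen_Suc[of "?t k i" l] 5 l less.prems assms(1) by (auto simp: Transposition.transpose_def)
      finally show ?thesis
        using 5 l by (auto simp: A_sym_def Transposition.transpose_def)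
    next
      case 6
      have "?T k (A_gen n i j) = ?T l (?T k (A_gen n i l))"
        using A conj_gen_far[of k l "A_gen n i l"] 6 l less.prems by simp
      also have "?T k (A_gen n i l) = A_gen n i l"
        using IH[of k] 6 l less.prems by (auto simp: A_sym_def Transposition.transpose_def)
      finally show ?thesis
        using 6 l A by (auto simp: A_sym_def Transposition.transpose_def)
    qed
  qed
qed

lemma A_sym_pure:
  assumes "i \<in> {1..n}" "j \<in> {1..n}" "i \<noteq> j"
  shows "A_sym n i j \<in> pure_classes n"
  using assms by (auto simp: A_sym_def min_def max_def intro!: A_gen_pure)

lemma conj_by_A_sym:
  assumes "w \<in> braid_words n" "i \<in> {1..n}" "j \<in> {1..n}" "i \<noteq> j"
  shows "conj_by n w (A_sym n i j) = A_sym n (word_perm w i) (word_perm w j)"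
  using assms(1)
proof (induction w)
  case Nil
  have "A_sym n i j \<in> carrier (braid_quotient n)"
    using A_sym_pure assms pure_classes_closed by blast
  then show ?case
    by (simp add: conj_by_def quotient_class_Nil)
next
  case (Cons x w)
  obtain k e where x: "x = (k, e)" by (cases x)
  have w: "w \<in> braid_words n" and k: "k \<in> {1..<n}" using Cons.prems x by auto
  define a b where "a = word_perm w i" and "b = word_perm w j"
  have ab: "a \<in> {1..n}" "b \<in> {1..n}" "a \<noteq> b"
    using word_perm_permutes[OF w] assms permutes_inj[OF word_perm_permutes[OF w]]
    by (auto simp only: a_def b_def permutes_in_image inj_eq)
  \<comment> \<open>The permutation of the tail may reverse the order of the indices; symmetry
    reduces that case to the ordered one.\<close>
  have sym: "A_sym n u v = A_sym n v u" for u v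
    by (simp add: A_sym_def min.commute max.commute)
  have "conj_by n (x # w) (A_sym n i j) = conj_by n [(k, True)] (A_sym n a b)"
    using Cons.IH[OF w] w k x A_sym_pure[OF assms(2-4)] A_sym_pure[OF ab]
    by (simp add: conj_by_Cons pure_classes_closed conj_gen_sign[where e = e] a_def b_def)
  also have "\<dots> = A_sym n (Transposition.transpose k (Suc k) a) (Transposition.transpose k (Suc k) b)"
  proof (cases "a < b")
    case True
    then show ?thesis
      using conj_gen_A_gen[of a b k] k ab by (simp add: A_sym_def)
  next
    case False
    then show ?thesis
      using conj_gen_A_gen[of b a k] k ab by (subst (1 2) sym) (simp add: A_sym_def)
  qed
  finally show ?case by (simp add: x a_def b_def)
qed

end

section \<open>The structure of \<open>\<Gamma>\<close>\<close>

primrec desc_prod :: "('a, 'b) monoid_scheme \<Rightarrow> (nat \<Rightarrow> 'a) \<Rightarrow> nat \<Rightarrow> 'a" where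
  "desc_prod G s 0 = \<one>\<^bsub>G\<^esub>"
| "desc_prod G s (Suc k) = s (Suc k) \<otimes>\<^bsub>G\<^esub> desc_prod G s k"

text \<open>The product s_a s_{a+1} ... s_{a+l-1}; the last argument counts factors.\<close>

primrec asc_prod :: "('a, 'b) monoid_scheme \<Rightarrow> (nat \<Rightarrow> 'a) \<Rightarrow> nat \<Rightarrow> nat \<Rightarrow> 'a" where
  "asc_prod G s a 0 = \<one>\<^bsub>G\<^esub>"
| "asc_prod G s a (Suc l) = s a \<otimes>\<^bsub>G\<^esub> asc_prod G s (Suc a) l"

context group
begin

context
  fixes s :: "nat \<Rightarrow> 'a" and m :: nat
  assumes closed [simp]: "\<And>k. s k \<in> carrier G"
    and far: "\<And>k l. k + 2 \<le> l \<Longrightarrow> s k \<otimes> s l = s l \<otimes> s k"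
    and braid: "\<And>k. 1 \<le> k \<Longrightarrow> Suc k \<le> m \<Longrightarrow> s k \<otimes> (s (Suc k) \<otimes> s k) = s (Suc k) \<otimes> (s k \<otimes> s (Suc k))"
begin

lemma desc_prod_closed [simp]: "desc_prod G s k \<in> carrier G"
  by (induction k) auto

lemma asc_prod_closed [simp]: "asc_prod G s a l \<in> carrier G"
  by (induction l arbitrary: a) auto

lemma desc_prod_far: "k + 2 \<le> l \<Longrightarrow> desc_prod G s k \<otimes> s l = s l \<otimes> desc_prod G s k"
proof (induction k)
  case (Suc k)
  have "desc_prod G s (Suc k) \<otimes> s l = s (Suc k) \<otimes> (s l \<otimes> desc_prod G s k)"
    using Suc by (simp add: m_assoc)
  also have "\<dots> = s l \<otimes> (s (Suc k) \<otimes> desc_prod G s k)"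
    using far[of "Suc k" l] Suc.prems by (simp add: m_assoc[symmetric])
  finally show ?case by simp
qed simp

text \<open>The descending product conjugates s_{i+1} to s_i. At k = i + 1 this is the braid
  relation after moving s_{i+1} past s_{i-1} ... s_1; every further factor on the left commutes with
  s_i.\<close>

lemma desc_prod_shift:
  assumes "1 \<le> i" "Suc i \<le> k" "k \<le> m"
  shows "desc_prod G s k \<otimes> s (Suc i) = s i \<otimes> desc_prod G s k"
  using assms(2,3)
proof (induction k rule: dec_induct)
  case base
  obtain j where j: "i = Suc j" using assms(1) by (cases i) auto
  have "desc_prod G s (Suc i) \<otimes> s (Suc i) = s (Suc i) \<otimes> (s i \<otimes> (desc_prod G s j \<otimes> s (Suc i)))"
    by (simp add: j m_assoc)
  also have "\<dots> = s (Suc i) \<otimes> (s i \<otimes> s (Suc i)) \<otimes> desc_prod G s j"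
    using desc_prod_far[of j "Suc i"] j by (simp add: m_assoc)
  also have "\<dots> = s i \<otimes> (s (Suc i) \<otimes> s i) \<otimes> desc_prod G s j"
    using braid[of i] base assms(1) by simp
  also have "\<dots> = s i \<otimes> desc_prod G s (Suc i)"
    by (simp add: j m_assoc)
  finally show ?case .
next
  case (step k)
  have "desc_prod G s (Suc k) \<otimes> s (Suc i) = s (Suc k) \<otimes> (s i \<otimes> desc_prod G s k)"
    using step by (simp add: m_assoc)
  also have "\<dots> = s i \<otimes> (s (Suc k) \<otimes> desc_prod G s k)"
    using far[of i "Suc k"] step by (simp add: m_assoc[symmetric])
  finally show ?case by simp
qed

lemma desc_prod_asc_prod:
  assumes "1 \<le> a" "a + l \<le> k" "k \<le> m"
  shows "desc_prod G s k \<otimes> asc_prod G s (Suc a) l = asc_prod G s a l \<otimes> desc_prod G s k"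
  using assms
proof (induction l arbitrary: a)
  case (Suc l)
  have "desc_prod G s k \<otimes> asc_prod G s (Suc a) (Suc l)
      = s a \<otimes> (desc_prod G s k \<otimes> asc_prod G s (Suc (Suc a)) l)"
    using desc_prod_shift[of a k] Suc.prems by (simp add: m_assoc[symmetric])
  also have "\<dots> = s a \<otimes> (asc_prod G s (Suc a) l \<otimes> desc_prod G s k)"
    using Suc by simp
  finally show ?case by (simp add: m_assoc)
qed simp

lemma asc_prod_snoc: "asc_prod G s a (Suc l) = asc_prod G s a l \<otimes> s (a + l)"
proof (induction l arbitrary: a)
  case (Suc l)
  have "asc_prod G s a (Suc (Suc l)) = s a \<otimes> asc_prod G s (Suc a) (Suc l)"
    by (rule asc_prod.simps)
  also have "\<dots> = s a \<otimes> (asc_prod G s (Suc a) l \<otimes> s (Suc a + l))"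
    by (simp only: Suc)
  finally show ?case by (simp add: m_assoc)
qed simp

text \<open>Each additional factor s_{k+1} ... s_1 passes through the ascending product, lowering
  its indices by one; its letter s_{k+1} then completes that product on the right and leaves s_k ...
  s_1 behind.\<close>

lemma desc_prod_power:
  assumes "Suc k \<le> m" "j \<le> Suc k"
  shows "desc_prod G s (Suc k) [^] j = asc_prod G s (Suc (Suc k) - j) j \<otimes> desc_prod G s k [^] j"
  using assms(2)
proof (induction j)
  case (Suc j)
  have a: "Suc (Suc k) - j = Suc (Suc k - j)" using Suc.prems by simp
  have "desc_prod G s (Suc k) [^] Suc j
      = desc_prod G s (Suc k) \<otimes> asc_prod G s (Suc (Suc k - j)) j \<otimes> desc_prod G s k [^] j"
    using Suc a by (simp only: nat_pow_Suc2[OF desc_prod_closed]) (simp add: m_assoc)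
  also have "\<dots> = asc_prod G s (Suc k - j) j \<otimes> desc_prod G s (Suc k) \<otimes> desc_prod G s k [^] j"
    using desc_prod_asc_prod[of "Suc k - j" j "Suc k"] Suc.prems assms(1) by simp
  also have "\<dots> = asc_prod G s (Suc k - j) j \<otimes> s (Suc k) \<otimes> (desc_prod G s k \<otimes> desc_prod G s k [^] j)"
    by (simp add: m_assoc)
  also have "asc_prod G s (Suc k - j) j \<otimes> s (Suc k) = asc_prod G s (Suc k - j) (Suc j)"
    using Suc.prems by (simp only: asc_prod_snoc) simp
  finally show ?case
    by (simp only: nat_pow_Suc2[OF desc_prod_closed] diff_Suc_Suc)
qed simp

lemma desc_prod_asc_prod_one:
  assumes "\<And>k. s k \<otimes> s k = \<one>"
  shows "desc_prod G s k \<otimes> asc_prod G s 1 k = \<one>"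
proof (induction k)
  case (Suc k)
  have "desc_prod G s (Suc k) \<otimes> asc_prod G s 1 (Suc k)
      = s (Suc k) \<otimes> (desc_prod G s k \<otimes> asc_prod G s 1 k) \<otimes> s (Suc k)"
    by (simp only: asc_prod_snoc) (simp add: m_assoc)
  then show ?case using Suc assms by simp
qed simp

text \<open>A Coxeter element of the symmetric group on \<open>k + 1\<close> points has order dividing \<open>k + 1\<close>.\<close>

lemma desc_prod_power_eq_one:
  assumes "\<And>k. s k \<otimes> s k = \<one>" "k \<le> m"
  shows "desc_prod G s k [^] Suc k = \<one>"
  using assms(2)
proof (induction k)
  case (Suc k)
  \<comment> \<open>At exponent k + 1 the ascending product starts at index 1. For involutions it is
    inverse to the descending product, which leaves the power covered by the induction
    hypothesis.\<close>
  have "desc_prod G s (Suc k) [^] Suc (Suc k)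
      = desc_prod G s (Suc k) \<otimes> (asc_prod G s 1 (Suc k) \<otimes> desc_prod G s k [^] Suc k)"
    using desc_prod_power[of k "Suc k"] Suc.prems by (simp only: nat_pow_Suc2[OF desc_prod_closed, of _ "Suc k"]) simp
  then show ?case
    using desc_prod_asc_prod_one[OF assms(1), of "Suc k"] Suc.IH Suc.prems
    by (simp only: r_one asc_prod_closed Suc_leD)
qed simp

end

end

section \<open>The word of the generator x, its permutation and its n-th power\<close>

lemma word_perm_fst_cong: "map fst u = map fst v \<Longrightarrow> word_perm u = word_perm v"
proof (induction u arbitrary: v)
  case (Cons x u)
  then obtain y v' where v: "v = y # v'" "fst y = fst x" "map fst u = map fst v'"
    by (cases v) auto
  then show ?case using Cons.IH[OF v(3)] by simp
qed simp

lemma braid_words_iff: "w \<in> braid_words n \<longleftrightarrow> set (map fst w) \<subseteq> {1..<n}"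
  by (induction w) auto

lemma word_perm_desc:
  assumes "1 \<le> m"
  shows "word_perm (pos_word (rev [1..<m])) i = (if i = 1 then m else if 2 \<le> i \<and> i \<le> m then i - 1 else i)"
  using assms
proof (induction m rule: dec_induct)
  case base
  then show ?case by (auto simp: pos_word_def)
next
  case (step m)
  have "pos_word (rev [1..<Suc m]) = (m, True) # pos_word (rev [1..<m])"
    using step(1) by (simp add: pos_word_def)
  then show ?case
    using step by (auto simp: Transposition.transpose_def)
qed

text \<open>Needed for two exponents: e = 1 generates the subgroup of all A_ij, e = n its part that
  is put into Gamma.\<close>

definition A_powers :: "nat \<Rightarrow> nat \<Rightarrow> braid_word set set set" where
  "A_powers n e = {A_gen n a b [^]\<^bsub>braid_quotient n\<^esub> e | a b. 1 \<le> a \<and> a < b \<and> b \<le> n}"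

text \<open>The generator of \<open>\<Gamma>\<close> mapping onto a generator of the holonomy group.\<close>

definition gamma_word :: "nat \<Rightarrow> braid_word" where
  "gamma_word n = [(1, True), (1, True)]
     @ pos_word (rev [(n + 1) div 2..<n]) @ neg_word (rev [1..<(n + 1) div 2])"

context
  fixes n :: nat
begin

interpretation Q: group "braid_quotient n"
  by (rule group_braid_quotient)

lemma conj_by_pow:
  assumes "w \<in> braid_words n" "a \<in> carrier (braid_quotient n)"
  shows "conj_by n w (a [^]\<^bsub>braid_quotient n\<^esub> (e::nat)) = conj_by n w a [^]\<^bsub>braid_quotient n\<^esub> e"
proof (induction e)
  case (Suc e)
  have "conj_by n w (a [^]\<^bsub>braid_quotient n\<^esub> Suc e)
      = conj_by n w (a [^]\<^bsub>braid_quotient n\<^esub> e) \<otimes>\<^bsub>braid_quotient n\<^esub> conj_by n w a"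
    using assms by (simp add: conj_by_def Q.m_assoc) (simp add: Q.m_assoc[symmetric])
  then show ?case using Suc by simp
qed (use assms in \<open>simp add: conj_by_def\<close>)

lemma A_powers_closed: "A_powers n e \<subseteq> carrier (braid_quotient n)"
  using A_gen_pure pure_classes_closed by (fastforce simp: A_powers_def)

lemma A_powers_sym:
  "A_powers n e = {A_sym n a b [^]\<^bsub>braid_quotient n\<^esub> e | a b. a \<in> {1..n} \<and> b \<in> {1..n} \<and> a \<noteq> b}"
proof (intro equalityI subsetI)
  fix x assume "x \<in> A_powers n e"
  then obtain a b where ab: "1 \<le> a" "a < b" "b \<le> n" "x = A_gen n a b [^]\<^bsub>braid_quotient n\<^esub> e"
    by (auto simp: A_powers_def)
  then have "x = A_sym n a b [^]\<^bsub>braid_quotient n\<^esub> e" by (simp add: A_sym_def)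
  with ab show "x \<in> {A_sym n a b [^]\<^bsub>braid_quotient n\<^esub> e | a b. a \<in> {1..n} \<and> b \<in> {1..n} \<and> a \<noteq> b}"
    by force
next
  fix x assume "x \<in> {A_sym n a b [^]\<^bsub>braid_quotient n\<^esub> e | a b. a \<in> {1..n} \<and> b \<in> {1..n} \<and> a \<noteq> b}"
  then obtain a b where ab: "a \<in> {1..n}" "b \<in> {1..n}" "a \<noteq> b" "x = A_sym n a b [^]\<^bsub>braid_quotient n\<^esub> e"
    by auto
  then have "1 \<le> min a b" "min a b < max a b" "max a b \<le> n" by auto
  with ab(4) show "x \<in> A_powers n e" unfolding A_powers_def A_sym_def by blast
qed

text \<open>Conjugation permutes the generating set through the symmetric group, so the set is
  invariant even before generating.\<close>

lemma generate_A_powers_normal: "generate (braid_quotient n) (A_powers n e) \<lhd> braid_quotient n"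
proof (rule Q.normal_generateI[OF A_powers_closed])
  fix h g assume "h \<in> A_powers n e" "g \<in> carrier (braid_quotient n)"
  then obtain a b where ab: "a \<in> {1..n}" "b \<in> {1..n}" "a \<noteq> b"
    and h: "h = A_sym n a b [^]\<^bsub>braid_quotient n\<^esub> e"
    unfolding A_powers_sym by auto
  obtain w where w: "w \<in> braid_words n" "g = quotient_class n w"
    using \<open>g \<in> carrier (braid_quotient n)\<close> by (rule carrier_braid_quotientE)
  have p: "word_perm w permutes {1..n}" by (rule word_perm_permutes[OF w(1)])
  have "g \<otimes>\<^bsub>braid_quotient n\<^esub> h \<otimes>\<^bsub>braid_quotient n\<^esub> inv\<^bsub>braid_quotient n\<^esub> g = conj_by n w h"
    by (simp add: conj_by_def w)
  also have "\<dots> = A_sym n (word_perm w a) (word_perm w b) [^]\<^bsub>braid_quotient n\<^esub> e"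
    using w ab A_sym_pure[OF ab] by (simp add: h conj_by_pow pure_classes_closed conj_by_A_sym)
  also have "\<dots> \<in> A_powers n e"
    using ab permutes_in_image[OF p] inj_eq[OF permutes_inj[OF p]] unfolding A_powers_sym by blast
  finally show "g \<otimes>\<^bsub>braid_quotient n\<^esub> h \<otimes>\<^bsub>braid_quotient n\<^esub> inv\<^bsub>braid_quotient n\<^esub> g \<in> A_powers n e" .
qed

lemma generate_A_powers_pure:
  assumes "h \<in> generate (braid_quotient n) (A_powers n e)"
  shows "h \<in> pure_classes n"
proof -
  have mult: "a \<otimes>\<^bsub>braid_quotient n\<^esub> b \<in> pure_classes n" if "a \<in> pure_classes n" "b \<in> pure_classes n" for a b
    using that by (auto simp: pure_classes_def quotient_class_append[symmetric] word_perm_append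
        intro!: imageI)
  have one: "\<one>\<^bsub>braid_quotient n\<^esub> \<in> pure_classes n"
    using pure_classesI[of "[]" n] by (simp add: quotient_class_Nil)
  have inv: "inv\<^bsub>braid_quotient n\<^esub> a \<in> pure_classes n" if a: "a \<in> pure_classes n" for a
  proof -
    obtain w where w: "w \<in> braid_words n" "word_perm w = id" "a = quotient_class n w"
      using a by (auto simp: pure_classes_def)
    obtain w' where w': "w' \<in> braid_words n" "word_perm w \<circ> word_perm w' = id"
      "quotient_class n w' = inv\<^bsub>braid_quotient n\<^esub> quotient_class n w"
      using quotient_class_inverse[OF w(1)] .
    then show ?thesis using w by (auto intro!: pure_classesI simp flip: w'(3))
  qed
  have pow: "a [^]\<^bsub>braid_quotient n\<^esub> k \<in> pure_classes n" if "a \<in> pure_classes n" for a and k :: nat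
    using that by (induction k) (auto simp: one mult)
  have gens: "A_powers n e \<subseteq> pure_classes n"
    by (auto simp: A_powers_def intro!: pow A_gen_pure)
  show ?thesis
    using assms by (induction rule: generate.induct) (use gens in \<open>auto simp: one inv mult\<close>)
qed

text \<open>On commuting elements the e-th power map is a homomorphism, and it sends A_ij to
  A_ij^e.\<close>

lemma generate_A_powers_pow:
  assumes "h \<in> generate (braid_quotient n) (A_powers n 1)"
  shows "h [^]\<^bsub>braid_quotient n\<^esub> e \<in> generate (braid_quotient n) (A_powers n e)"
  using assms
proof (induction rule: generate.induct)
  case one
  then show ?case by (simp add: generate.one)
next
  case (incl h)
  then obtain a b where "1 \<le> a" "a < b" "b \<le> n" "h = A_gen n a b"
    using A_gen_pure pure_classes_closed by (auto simp: A_powers_def)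
  then have "h [^]\<^bsub>braid_quotient n\<^esub> e \<in> A_powers n e" by (auto simp: A_powers_def)
  then show ?case by (rule generate.incl)
next
  case (inv h)
  then obtain a b where h: "1 \<le> a" "a < b" "b \<le> n" "h = A_gen n a b"
    using A_gen_pure pure_classes_closed by (auto simp: A_powers_def)
  then have "h [^]\<^bsub>braid_quotient n\<^esub> e \<in> A_powers n e" by (auto simp: A_powers_def)
  then show ?case
    using h A_gen_pure pure_classes_closed by (simp add: Q.nat_pow_inv generate.inv)
next
  case (eng h1 h2)
  then have "h1 \<in> pure_classes n" "h2 \<in> pure_classes n"
    using generate_A_powers_pure by blast+
  then show ?case
    using eng by (simp add: Q.pow_mult_distrib pure_classes_commute pure_classes_closed generate.eng)
qed

lemma gamma_word:
  assumes "2 \<le> n"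
  shows "gamma_word n \<in> braid_words n"
proof -
  have "1 \<le> (n + 1) div 2" "(n + 1) div 2 \<le> n" using assms by auto
  then show ?thesis using assms by (auto simp: gamma_word_def pos_word_def neg_word_def braid_words_def)
qed

lemma quotient_class_gamma_word:
  assumes "2 \<le> n"
  shows "quotient_class n (gamma_word n) = A_gen n 1 2 \<otimes>\<^bsub>braid_quotient n\<^esub> delta0 n"
proof -
  have "pos_word (rev [(n + 1) div 2..<n]) @ neg_word (rev [1..<(n + 1) div 2]) \<in> braid_words n"
    using gamma_word[OF assms] by (simp add: gamma_word_def)
  then show ?thesis
    using assms A_gen_adjacent[of n 1] unfolding gamma_word_def delta0_def
    by (subst quotient_class_append) (auto simp: numeral_2_eq_2)
qed

lemma map_fst_gamma_word:
  assumes "2 \<le> n"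
  shows "map fst (gamma_word n) = map fst ([(1, True), (1, True)] @ pos_word (rev [1..<n]))"
proof -
  have "[1..<n] = [1..<(n + 1) div 2] @ [(n + 1) div 2..<n]"
    using assms upt_add_eq_append[of 1 "(n + 1) div 2" "n - (n + 1) div 2"] by auto
  then show ?thesis
    by (simp add: gamma_word_def pos_word_def neg_word_def o_def)
qed

lemma word_perm_gamma_word:
  assumes "2 \<le> n"
  shows "word_perm (gamma_word n) i = (if i = 1 then n else if 2 \<le> i \<and> i \<le> n then i - 1 else i)"
  using word_perm_fst_cong[OF map_fst_gamma_word[OF assms]] word_perm_desc[of n i] assms
  by (simp add: word_perm_append del: upt_Suc)

text \<open>Since sigma_k^2 = A_{k,k+1}, the letters become involutions modulo the subgroup H of the
  A_ij. Signs then disappear, the initial sigma_1^2 vanishes, and x becomes the Coxeter element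
  s_{n-1} ... s_1, whose n-th power is trivial.\<close>

lemma gamma_word_pow:
  assumes "2 \<le> n"
  shows "quotient_class n (gamma_word n) [^]\<^bsub>braid_quotient n\<^esub> n \<in> generate (braid_quotient n) (A_powers n 1)"
proof -
  let ?Q = "braid_quotient n"
  define H where "H = generate ?Q (A_powers n 1)"
  interpret H: normal H ?Q
    unfolding H_def by (rule generate_A_powers_normal)
  interpret F: group "?Q Mod H"
    by (rule H.factorgroup_is_group)
  interpret q: group_hom ?Q "?Q Mod H" "\<lambda>a. H #>\<^bsub>?Q\<^esub> a"
    by (intro group_hom.intro group_hom_axioms.intro H.r_coset_hom_Mod Q.group_axioms F.group_axioms)
  note [simp del] = mult_FactGroup one_FactGroup
  obtain m where m: "n = Suc m" using assms by (cases n) auto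
  define h where "h w = H #>\<^bsub>?Q\<^esub> quotient_class n w" for w
  have h_append: "h (u @ v) = h u \<otimes>\<^bsub>?Q Mod H\<^esub> h v" if "u \<in> braid_words n" "v \<in> braid_words n" for u v
    unfolding h_def quotient_class_append[OF that]
    by (rule q.hom_mult) (use that in simp_all)
  have h_closed [simp]: "h w \<in> carrier (?Q Mod H)" if "w \<in> braid_words n" for w
    unfolding h_def using that by (intro q.hom_closed) simp
  have h_cong: "h u = h v" if "braid_equiv n u v" for u v
    using quotient_class_cong[OF that] by (simp add: h_def)
  have h_H: "h w = \<one>\<^bsub>?Q Mod H\<^esub>" if "quotient_class n w \<in> H" for w
    using Q.coset_join2[OF _ H.subgroup_axioms that] that H.subset by (auto simp: h_def one_FactGroup)
  have h_Nil: "h [] = \<one>\<^bsub>?Q Mod H\<^esub>"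
    by (rule h_H) (simp add: quotient_class_Nil H.one_closed)
  have h_square: "h [(k, True), (k, True)] = \<one>\<^bsub>?Q Mod H\<^esub>" if "k \<in> {1..<n}" for k
  proof (rule h_H)
    have "A_gen n k (Suc k) [^]\<^bsub>?Q\<^esub> (1::nat) \<in> A_powers n 1"
      using that unfolding A_powers_def by fastforce
    then have "A_gen n k (Suc k) \<in> A_powers n 1"
      using that A_gen_pure[of k "Suc k" n] pure_classes_closed by simp
    then show "quotient_class n [(k, True), (k, True)] \<in> H"
      unfolding H_def A_gen_adjacent by (rule generate.incl)
  qed
  have h_sign: "h [(k, e)] = h [(k, True)]" if k: "k \<in> {1..<n}" for k e
  proof (cases e)
    case False
    have "h [(k, False)] \<otimes>\<^bsub>?Q Mod H\<^esub> h [(k, True)] = \<one>\<^bsub>?Q Mod H\<^esub>"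
      using h_append[of "[(k, False)]" "[(k, True)]"] h_cong[OF braid_equiv.cancel[OF k, of False]] k h_Nil
      by simp
    moreover have "h [(k, True)] \<otimes>\<^bsub>?Q Mod H\<^esub> h [(k, True)] = \<one>\<^bsub>?Q Mod H\<^esub>"
      using h_append[of "[(k, True)]" "[(k, True)]"] h_square[OF k] k by simp
    ultimately show ?thesis
      using k False by (metis F.inv_equality h_closed braid_words_Cons braid_words_Nil fst_conv)
  qed simp
  have h_fst: "h u = h v" if "map fst u = map fst v" "u \<in> braid_words n" for u v
    using that
  proof (induction u arbitrary: v)
    case (Cons x u)
    then obtain y v' where v: "v = y # v'" "fst y = fst x" "map fst u = map fst v'"
      by (cases v) auto
    have v': "v' \<in> braid_words n"
      using Cons.prems(2) v(3) by (simp add: braid_words_iff del: set_map)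
    have "h (x # u) = h [x] \<otimes>\<^bsub>?Q Mod H\<^esub> h u"
      using h_append[of "[x]" u] Cons.prems by simp
    also have "h [x] = h [y]"
      using h_sign[of "fst x" "snd x"] h_sign[of "fst x" "snd y"] Cons.prems v by (cases y) auto
    also have "h u = h v'"
      using Cons.IH v Cons.prems by simp
    also have "h [y] \<otimes>\<^bsub>?Q Mod H\<^esub> h v' = h v"
      using h_append[of "[y]" v'] v v' Cons.prems by simp
    finally show ?case .
  qed simp
  \<comment> \<open>Padding by the identity gives closure, involutivity and far commutation at all
    indices; only the braid relation has to stay within the range.\<close>
  define s where "s k = (if k \<in> {1..<n} then h [(k, True)] else \<one>\<^bsub>?Q Mod H\<^esub>)" for k
  have s_closed: "s k \<in> carrier (?Q Mod H)" for k
    using F.one_closed by (auto simp: s_def)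
  have s_square: "s k \<otimes>\<^bsub>?Q Mod H\<^esub> s k = \<one>\<^bsub>?Q Mod H\<^esub>" for k
    using h_append[of "[(k, True)]" "[(k, True)]"] h_square by (auto simp: s_def)
  have s_far: "s k \<otimes>\<^bsub>?Q Mod H\<^esub> s l = s l \<otimes>\<^bsub>?Q Mod H\<^esub> s k" if "k + 2 \<le> l" for k l
    using h_append[of "[(k, True)]" "[(l, True)]"] h_append[of "[(l, True)]" "[(k, True)]"]
      h_cong[OF braid_equiv.far_comm[of k n l]] that by (auto simp: s_def)
  have s_braid: "s k \<otimes>\<^bsub>?Q Mod H\<^esub> (s (Suc k) \<otimes>\<^bsub>?Q Mod H\<^esub> s k)
      = s (Suc k) \<otimes>\<^bsub>?Q Mod H\<^esub> (s k \<otimes>\<^bsub>?Q Mod H\<^esub> s (Suc k))" if "1 \<le> k" "Suc k \<le> m" for k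
  proof -
    have e: "h [(a, True), (b, True), (a, True)] = s a \<otimes>\<^bsub>?Q Mod H\<^esub> (s b \<otimes>\<^bsub>?Q Mod H\<^esub> s a)"
      if "a \<in> {1..<n}" "b \<in> {1..<n}" for a b
      using h_append[of "[(a, True)]" "[(b, True), (a, True)]"] h_append[of "[(b, True)]" "[(a, True)]"] that
      by (simp add: s_def)
    show ?thesis
      using h_cong[OF braid_equiv.braid[of k n]] e[of k "Suc k"] e[of "Suc k" k] that m by simp
  qed
  have desc: "h (pos_word (rev [1..<Suc m])) = desc_prod (?Q Mod H) s m" if "m < n" for m
    using that
  proof (induction m)
    case 0
    then show ?case by (simp add: pos_word_def h_Nil)
  next
    case (Suc m)
    let ?w = "pos_word (rev [1..<Suc m])"
    have "pos_word (rev [1..<Suc (Suc m)]) = [(Suc m, True)] @ ?w"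
      by (simp add: pos_word_def)
    moreover have "?w \<in> braid_words n"
      using Suc.prems by (auto simp: pos_word_def braid_words_def)
    ultimately have "h (pos_word (rev [1..<Suc (Suc m)])) = h [(Suc m, True)] \<otimes>\<^bsub>?Q Mod H\<^esub> h ?w"
      using h_append[of "[(Suc m, True)]" ?w] Suc.prems by (simp only:) simp
    also have "h ?w = desc_prod (?Q Mod H) s m"
      using Suc by simp
    also have "h [(Suc m, True)] = s (Suc m)"
      using Suc.prems by (simp add: s_def)
    finally show ?case by (simp only: desc_prod.simps)
  qed
  have coxeter: "desc_prod (?Q Mod H) s m [^]\<^bsub>?Q Mod H\<^esub> Suc m = \<one>\<^bsub>?Q Mod H\<^esub>"
    by (rule F.desc_prod_power_eq_one[where m = m]) (fact s_closed s_far s_braid s_square order_refl)+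
  have pos: "pos_word (rev [1..<n]) \<in> braid_words n"
    by (auto simp: pos_word_def braid_words_def)
  have "h (gamma_word n) = h ([(1, True), (1, True)] @ pos_word (rev [1..<n]))"
    by (rule h_fst[OF map_fst_gamma_word[OF assms] gamma_word[OF assms]])
  also have "\<dots> = h (pos_word (rev [1..<n]))"
    using h_append[of "[(1, True), (1, True)]" "pos_word (rev [1..<n])"] h_square[of 1] assms pos
    by (simp del: append.simps)
  also have "\<dots> = desc_prod (?Q Mod H) s m"
    using desc[of m] m by simp
  finally have "h (gamma_word n) [^]\<^bsub>?Q Mod H\<^esub> n = \<one>\<^bsub>?Q Mod H\<^esub>"
    using coxeter by (simp only: m)
  then have "H #>\<^bsub>?Q\<^esub> (quotient_class n (gamma_word n) [^]\<^bsub>?Q\<^esub> n) = H"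
    using q.hom_nat_pow[of "quotient_class n (gamma_word n)" n] gamma_word[OF assms]
    by (simp add: h_def one_FactGroup)
  then show ?thesis
    using Q.coset_join1[OF _ _ H.subgroup_axioms] gamma_word[OF assms] H_def by simp
qed

lemma Gamma_set_eq: "2 \<le> n \<Longrightarrow> Gamma_set n = generate (braid_quotient n)
    (insert (quotient_class n (gamma_word n)) (A_powers n n))"
  by (simp add: Gamma_set_def quotient_class_gamma_word A_powers_def)

text \<open>H is normal, so H times the cyclic group of x is a subgroup containing all generators of
  Gamma; as x^(n^2) is in H, finitely many powers of x represent all cosets.\<close>

lemma Gamma_set_decomp:
  assumes "2 \<le> n" "g \<in> Gamma_set n"
  obtains h r where "h \<in> generate (braid_quotient n) (A_powers n n)" "r < n * n"
    "g = h \<otimes>\<^bsub>braid_quotient n\<^esub> quotient_class n (gamma_word n) [^]\<^bsub>braid_quotient n\<^esub> (r::nat)"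
proof -
  let ?Q = "braid_quotient n"
  define x where "x = quotient_class n (gamma_word n)"
  define H where "H = generate ?Q (A_powers n n)"
  have x: "x \<in> carrier ?Q" using gamma_word[OF assms(1)] by (simp add: x_def)
  have H: "H \<lhd> ?Q" unfolding H_def by (rule generate_A_powers_normal)
  interpret H: normal H ?Q by (rule H)
  \<comment> \<open>x^n is a product of classes A_ij and their inverses; its n-th power is one of
    the A_ij^n and their inverses.\<close>
  have "x [^]\<^bsub>?Q\<^esub> (n * n) \<in> H"
    using generate_A_powers_pow[OF gamma_word_pow[OF assms(1)], of n] x
    by (simp add: Q.nat_pow_pow x_def H_def)
  then have xM: "(x [^]\<^bsub>?Q\<^esub> (int (n * n))) [^]\<^bsub>?Q\<^esub> (q::int) \<in> H" for q
    by (simp add: int_pow_int Q.subgroup_int_pow_closed[OF H.subgroup_axioms] del: of_nat_mult)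
  have "subgroup (H <#>\<^bsub>?Q\<^esub> generate ?Q {x}) ?Q"
    by (intro Q.mult_norm_subgroup H Q.generate_is_subgroup) (use x in simp)
  moreover have "insert x (A_powers n n) \<subseteq> H <#>\<^bsub>?Q\<^esub> generate ?Q {x}"
  proof -
    have mult: "u \<otimes>\<^bsub>?Q\<^esub> v \<in> H <#>\<^bsub>?Q\<^esub> generate ?Q {x}" if "u \<in> H" "v \<in> generate ?Q {x}" for u v
      using that by (auto simp: set_mult_def)
    have "x \<in> H <#>\<^bsub>?Q\<^esub> generate ?Q {x}"
      using mult[OF H.one_closed generate.incl[of x "{x}"]] x by simp
    moreover have "a \<in> H <#>\<^bsub>?Q\<^esub> generate ?Q {x}" if "a \<in> A_powers n n" for a
    proof -
      have "a \<in> H" unfolding H_def by (rule generate.incl[OF that])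
      then show ?thesis
        using mult[OF _ generate.one, of a] H.mem_carrier[of a] by simp
    qed
    ultimately show ?thesis by auto
  qed
  ultimately have "Gamma_set n \<subseteq> H <#>\<^bsub>?Q\<^esub> generate ?Q {x}"
    unfolding Gamma_set_eq[OF assms(1)] x_def[symmetric] by (rule Q.generate_subgroup_incl[rotated])
  then obtain h k where h: "h \<in> H" "g = h \<otimes>\<^bsub>?Q\<^esub> x [^]\<^bsub>?Q\<^esub> (k::int)"
    using assms(2) Q.generate_pow[OF x] by (auto simp: set_mult_def)
  \<comment> \<open>Division with remainder also covers negative exponents; the multiple of n^2 is
    absorbed into H.\<close>
  define r where "r = nat (k mod int (n * n))"
  have r: "int r = k mod int (n * n)" "r < n * n"
    using assms(1) by (auto simp: r_def nat_less_iff)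
  have "k = int (n * n) * (k div int (n * n)) + int r"
    by (simp add: r)
  then have "x [^]\<^bsub>?Q\<^esub> k = (x [^]\<^bsub>?Q\<^esub> (int (n * n))) [^]\<^bsub>?Q\<^esub> (k div int (n * n)) \<otimes>\<^bsub>?Q\<^esub> x [^]\<^bsub>?Q\<^esub> r"
    using Q.int_pow_mult[OF x, of "int (n * n) * (k div int (n * n))" "int r"] x
    by (simp only: int_pow_int[of ?Q x r] Q.int_pow_pow)
  with h x have "g = (h \<otimes>\<^bsub>?Q\<^esub> (x [^]\<^bsub>?Q\<^esub> (int (n * n))) [^]\<^bsub>?Q\<^esub> (k div int (n * n))) \<otimes>\<^bsub>?Q\<^esub> x [^]\<^bsub>?Q\<^esub> r"
    using H.subset by (auto simp: Q.m_assoc)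
  moreover have "h \<otimes>\<^bsub>?Q\<^esub> (x [^]\<^bsub>?Q\<^esub> (int (n * n))) [^]\<^bsub>?Q\<^esub> (k div int (n * n)) \<in> H"
    using h xM by (intro H.m_closed) auto
  ultimately show ?thesis
    using that r by (auto simp: H_def x_def)
qed

end

section \<open>Cocompact groups with an abelian subgroup of finite index\<close>

definition linear_part :: "('e::euclidean_space \<Rightarrow> 'e) \<Rightarrow> 'e \<Rightarrow> 'e" where
  "linear_part f x = f x - f 0"

lemma carrier_isometry_group:
  "f \<in> carrier isometry_group \<longleftrightarrow> bij f \<and> (\<forall>x y. dist (f x) (f y) = dist x y)"
  by (simp add: isometry_group_def)

lemma mult_isometry_group [simp]: "f \<otimes>\<^bsub>isometry_group\<^esub> g = f \<circ> g"
  and one_isometry_group [simp]: "\<one>\<^bsub>isometry_group\<^esub> = id"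
  by (simp_all add: isometry_group_def)

lemma group_isometry_group: "group (isometry_group :: ('e::euclidean_space \<Rightarrow> 'e) monoid)"
proof (rule groupI)
  fix f :: "'e \<Rightarrow> 'e" assume f: "f \<in> carrier isometry_group"
  have "dist (inv_into UNIV f x) (inv_into UNIV f y) = dist (f (inv_into UNIV f x)) (f (inv_into UNIV f y))" for x y
    using f by (simp add: carrier_isometry_group)
  then have "dist (inv_into UNIV f x) (inv_into UNIV f y) = dist x y" for x y
    using f by (simp add: carrier_isometry_group bij_is_surj surj_f_inv_f)
  moreover have "bij (inv_into UNIV f)" "inv_into UNIV f \<circ> f = id"
    using f by (simp_all add: carrier_isometry_group bij_imp_bij_inv bij_is_inj)
  ultimately show "\<exists>g\<in>carrier isometry_group. g \<otimes>\<^bsub>isometry_group\<^esub> f = \<one>\<^bsub>isometry_group\<^esub>"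
    by (intro bexI[of _ "inv_into UNIV f"]) (auto simp: carrier_isometry_group)
qed (auto simp: carrier_isometry_group comp_assoc intro: bij_comp)

lemma orthogonal_linear_part:
  assumes "f \<in> carrier isometry_group"
  shows "orthogonal_transformation (linear_part f)"
  using assms by (simp add: orthogonal_transformation_isometry linear_part_def carrier_isometry_group dist_norm)

lemma linear_linear_part: "f \<in> carrier isometry_group \<Longrightarrow> linear (linear_part f)"
  by (simp add: orthogonal_linear_part orthogonal_transformation_linear)

lemma linear_part_diff:
  assumes "f \<in> carrier isometry_group"
  shows "f x - f y = linear_part f (x - y)"
  using linear_diff[OF linear_linear_part[OF assms]] by (simp add: linear_part_def)

lemma linear_part_comp:
  assumes "f \<in> carrier isometry_group"
  shows "linear_part (f \<circ> g) = linear_part f \<circ> linear_part g"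
  using linear_part_diff[OF assms] by (auto simp: linear_part_def[of g] linear_part_def[of "f \<circ> g"])

text \<open>Scaling the argument makes a nonzero value arbitrarily large.\<close>

lemma linear_bounded_imp_zero:
  fixes f :: "'a::real_normed_vector \<Rightarrow> 'b::real_normed_vector"
  assumes "linear f" "\<And>x. norm (f x) \<le> B"
  shows "f x = 0"
proof (rule ccontr)
  assume "f x \<noteq> 0"
  then obtain k :: nat where "B < real k * norm (f x)"
    using reals_Archimedean3[of "norm (f x)"] by auto
  moreover have "norm (f (real k *\<^sub>R x)) = real k * norm (f x)"
    by (simp add: linear_scale[OF assms(1)])
  ultimately show False using assms(2)[of "real k *\<^sub>R x"] by simp
qed

section \<open>Orbits of groups of isometries\<close>

locale isometric_action =
  fixes G :: "('e::euclidean_space \<Rightarrow> 'e) set"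
  assumes subgroup: "subgroup G isometry_group"
begin

sublocale I: group "isometry_group :: ('e \<Rightarrow> 'e) monoid"
  by (rule group_isometry_group)

lemma isometry: "g \<in> G \<Longrightarrow> g \<in> carrier isometry_group"
  using subgroup.subset[OF subgroup] by blast

lemma dist_action: "g \<in> G \<Longrightarrow> dist (g x) (g y) = dist x y"
  using isometry by (simp add: carrier_isometry_group)

lemma id_mem: "id \<in> G"
  using subgroup.one_closed[OF subgroup] by simp

lemma comp_mem: "g \<in> G \<Longrightarrow> h \<in> G \<Longrightarrow> g \<circ> h \<in> G"
  using subgroup.m_closed[OF subgroup] by simp

lemma inverse_mem:
  assumes "g \<in> G"
  obtains h where "h \<in> G" "h \<circ> g = id" "g \<circ> h = id"
  using I.l_inv[OF isometry[OF assms]] I.r_inv[OF isometry[OF assms]]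
    subgroup.m_inv_closed[OF subgroup assms] by auto

lemma continuous_action: "g \<in> G \<Longrightarrow> continuous_on S g"
  unfolding continuous_on_iff using dist_action by auto

lemma orbit_map_eq_iff: "orbit_map G x = orbit_map G y \<longleftrightarrow> (\<exists>g\<in>G. y = g x)"
proof
  assume "orbit_map G x = orbit_map G y"
  moreover have "y \<in> orbit_map G y" unfolding orbit_map_def using id_mem by (intro image_eqI[of _ _ id]) auto
  ultimately show "\<exists>g\<in>G. y = g x" by (auto simp: orbit_map_def)
next
  assume "\<exists>g\<in>G. y = g x"
  then obtain g where g: "g \<in> G" "y = g x" by blast
  obtain h where h: "h \<in> G" "h \<circ> g = id" using inverse_mem[OF g(1)] by blast
  have "f y \<in> orbit_map G x" if "f \<in> G" for f
    unfolding orbit_map_def using comp_mem[OF that g(1)] g(2) by (intro image_eqI[of _ _ "f \<circ> g"]) auto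
  moreover have "f x \<in> orbit_map G y" if "f \<in> G" for f
  proof -
    have "f x = (f \<circ> h) y" using h(2) g(2) by (simp add: fun_eq_iff)
    then show ?thesis
      unfolding orbit_map_def using comp_mem[OF that h(1)] by (intro image_eqI[of _ _ "f \<circ> h"]) auto
  qed
  ultimately show "orbit_map G x = orbit_map G y" by (auto simp: orbit_map_def)
qed

text \<open>The saturation is the union of the preimages of U under the group elements, each of
  which is continuous.\<close>

lemma open_saturation:
  assumes "open U"
  shows "open (orbit_map G -` orbit_map G ` U)"
proof -
  have "orbit_map G -` orbit_map G ` U = (\<Union>g\<in>G. g -` U)"
  proof (intro equalityI subsetI)
    fix x assume "x \<in> orbit_map G -` orbit_map G ` U"
    then obtain y where "y \<in> U" "orbit_map G x = orbit_map G y" by blast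
    then show "x \<in> (\<Union>g\<in>G. g -` U)" unfolding orbit_map_eq_iff by blast
  next
    fix x assume "x \<in> (\<Union>g\<in>G. g -` U)"
    then obtain g where g: "g \<in> G" "g x \<in> U" by blast
    then have "orbit_map G x = orbit_map G (g x)" unfolding orbit_map_eq_iff by blast
    with g show "x \<in> orbit_map G -` orbit_map G ` U" by blast
  qed
  moreover have "open (g -` U)" if "g \<in> G" for g
    using assms continuous_action[OF that] by (simp add: continuous_on_eq_continuous_within continuous_open_vimage open_vimage)
  ultimately show ?thesis by auto
qed

lemma openin_orbit_image: "open U \<Longrightarrow> openin (orbit_space G) (orbit_map G ` U)"
  by (auto simp: openin_orbit_space open_saturation)

text \<open>The images of the balls about 0 cover the orbit space; the largest ball of a finite
  subcover meets every orbit.\<close>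

lemma cocompact_bound:
  assumes "compact_space (orbit_space G)"
  obtains B where "\<And>x. \<exists>g\<in>G. norm (g x) \<le> B"
proof -
  let ?U = "range (\<lambda>k::nat. orbit_map G ` ball 0 (real k))"
  have "\<Union>?U = topspace (orbit_space G)"
  proof -
    have "x \<in> \<Union>?U" if x: "x \<in> range (orbit_map G)" for x
    proof -
      obtain y where y: "x = orbit_map G y" using x by blast
      obtain k :: nat where "norm y < real k" using reals_Archimedean2 by blast
      then have "y \<in> ball 0 (real k)" by simp
      with y show ?thesis by blast
    qed
    then show ?thesis by (auto simp: topspace_orbit_space)
  qed
  moreover have "\<forall>U\<in>?U. openin (orbit_space G) U"
    by (auto intro: openin_orbit_image)
  ultimately obtain F where F: "finite F" "F \<subseteq> ?U" "topspace (orbit_space G) \<subseteq> \<Union>F"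
    using assms unfolding compact_space_alt by (metis (no_types, lifting) order_refl)
  obtain K where K: "finite K" "F = (\<lambda>k::nat. orbit_map G ` ball 0 (real k)) ` K"
    using finite_subset_image[OF F(1,2)] by blast
  \<comment> \<open>Inserting 0 keeps the maximum defined without a separate nonemptiness
    argument.\<close>
  have "\<exists>g\<in>G. norm (g x) \<le> real (Max (insert 0 K))" for x
  proof -
    have "orbit_map G x \<in> \<Union>F" using F(3) by (auto simp: topspace_orbit_space)
    then obtain k y where k: "k \<in> K" "norm y < real k" "orbit_map G x = orbit_map G y"
      unfolding K(2) by auto
    then obtain g where "g \<in> G" "y = g x" by (auto simp: orbit_map_eq_iff)
    moreover have "real k \<le> real (Max (insert 0 K))" using k K(1) by simp
    ultimately show ?thesis using k(2) by (auto intro!: bexI[of _ g])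
  qed
  then show ?thesis by (rule that)
qed

text \<open>In the topology of pointwise convergence a basic neighbourhood of the identity
  constrains only finitely many values; \<open>F\<close> collects these points.\<close>

lemma discrete_separation:
  assumes "discrete G"
  obtains e F where "e > 0" "finite F" "\<And>g. g \<in> G \<Longrightarrow> (\<And>x. x \<in> F \<Longrightarrow> dist (g x) x < e) \<Longrightarrow> g = id"
proof -
  have "id isolated_in G" using assms id_mem by (simp add: discrete_def)
  then obtain U where U: "open U" "U \<inter> G = {id}" by (auto simp: isolated_in_def)
  then have "openin (product_topology (\<lambda>i::'e. euclidean) UNIV) U"
    by (simp add: open_fun_def)
  from product_topology_open_contains_basis[OF this, of id] U(2)
  obtain W where W: "id \<in> (\<Pi>\<^sub>E i\<in>UNIV. W i)" "\<And>i. open (W i)" "finite {i. W i \<noteq> UNIV}"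
    "(\<Pi>\<^sub>E i\<in>UNIV. W i) \<subseteq> U" by auto
  define F where "F = {i. W i \<noteq> UNIV}"
  have "\<exists>e>0. ball i e \<subseteq> W i" for i
  proof -
    have "i \<in> W i" using W(1) by (simp add: PiE_iff)
    with W(2)[of i] show ?thesis using openE by blast
  qed
  then obtain \<epsilon> where \<epsilon>: "\<And>i. \<epsilon> i > 0" "\<And>i. ball i (\<epsilon> i) \<subseteq> W i" by metis
  define e where "e = Min (insert 1 (\<epsilon> ` F))"
  have "e > 0" using W(3) \<epsilon>(1) by (simp add: e_def F_def)
  moreover have "g = id" if g: "g \<in> G" "\<And>x. x \<in> F \<Longrightarrow> dist (g x) x < e" for g
  proof -
    have "g i \<in> W i" for i
    proof (cases "i \<in> F")
      case True
      then have "e \<le> \<epsilon> i" using W(3) by (simp add: e_def F_def)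
      then show ?thesis using g(2)[OF True] \<epsilon>(2)[of i] by (auto simp: dist_commute)
    qed (simp add: F_def)
    then have "g \<in> U" using W(4) by (auto simp: PiE_iff)
    then show ?thesis using g(1) U(2) by blast
  qed
  ultimately show ?thesis using that[of e F] W(3) F_def by blast
qed

end

text \<open>The data extracted from Gamma: \<open>T\<close> stands for the image of the subgroup
  generated by the A_ij^n, \<open>X\<close> for that of x, and \<open>M\<close> bounds the exponents
  of the coset representatives.\<close>

locale virtually_abelian_action = isometric_action G
  for G :: "('e::euclidean_space \<Rightarrow> 'e) set" +
  fixes T :: "('e \<Rightarrow> 'e) set" and X :: "'e \<Rightarrow> 'e" and M :: nat
  assumes compact: "compact_space (orbit_space G)"
    and discrete: "discrete G"
    and T_subgroup: "subgroup T isometry_group"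
    and T_subset: "T \<subseteq> G"
    and T_commute: "\<And>s t. s \<in> T \<Longrightarrow> t \<in> T \<Longrightarrow> s \<circ> t = t \<circ> s"
    and X_mem: "X \<in> G"
    and decomp: "\<And>g. g \<in> G \<Longrightarrow> \<exists>t\<in>T. \<exists>r<M. g = t \<circ> (X ^^ r)"
begin

sublocale T: isometric_action T
  by (rule isometric_action.intro) (rule T_subgroup)

lemma X_pow_mem: "X ^^ r \<in> G"
  by (induction r) (use id_mem comp_mem[OF X_mem] in \<open>simp_all only: funpow.simps\<close>)

lemma T_cocompact: obtains B where "\<And>y. \<exists>t\<in>T. norm (t y) \<le> B"
proof -
  obtain B where B: "\<And>x. \<exists>g\<in>G. norm (g x) \<le> B"
    using cocompact_bound[OF compact] by blast
  define C where "C = (\<Sum>r<M. norm ((X ^^ r) 0))"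
  have "\<exists>t\<in>T. norm (t y) \<le> B + C" for y
  proof -
    obtain g where g: "g \<in> G" "norm (g y) \<le> B" using B by blast
    \<comment> \<open>The inverse of g is decomposed rather than g: from h = t X^r and y = h (g y)
      the inverse s of t satisfies s y = X^r (g y), which is bounded because g y is and r takes
      finitely many values.\<close>
    obtain h where h: "h \<in> G" "h \<circ> g = id" using inverse_mem[OF g(1)] by blast
    obtain t r where t: "t \<in> T" "r < M" "h = t \<circ> (X ^^ r)" using decomp[OF h(1)] by blast
    obtain s where s: "s \<in> T" "s \<circ> t = id" using T.inverse_mem[OF t(1)] by blast
    have "s y = s (h (g y))" using h(2) by (simp add: fun_eq_iff)
    also have "\<dots> = (X ^^ r) (g y)" using t(3) s(2) by (simp add: fun_eq_iff)
    finally have "norm (s y) \<le> dist ((X ^^ r) (g y)) ((X ^^ r) 0) + norm ((X ^^ r) 0)"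
      by (metis dist_norm norm_triangle_sub add.commute)
    also have "\<dots> = norm (g y) + norm ((X ^^ r) 0)"
      using dist_action[OF X_pow_mem] by simp
    also have "norm ((X ^^ r) 0) \<le> C"
      unfolding C_def using t(2) by (intro member_le_sum) auto
    finally show ?thesis using s(1) g(2) by force
  qed
  then show ?thesis by (rule that)
qed

text \<open>The displacement of \<open>t \<in> T\<close> is constant on \<open>T\<close>-orbits, hence bounded by cocompactness.\<close>

lemma T_translation:
  assumes t: "t \<in> T"
  shows "t x = x + t 0"
proof -
  obtain B where B: "\<And>y. \<exists>t\<in>T. norm (t y) \<le> B" using T_cocompact by blast
  have "norm (linear_part t y - y) \<le> 2 * B + 2 * norm (t 0)" for y
  proof -
    obtain s where s: "s \<in> T" "norm (s y) \<le> B" using B by blast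
    have "dist (t y) y = dist (s (t y)) (s y)" using T.dist_action[OF s(1)] by simp
    also have "s (t y) = t (s y)" using T_commute[OF s(1) t] by (simp add: fun_eq_iff)
    also have "dist (t (s y)) (s y) \<le> dist (t (s y)) (t 0) + dist (t 0) (s y)" by (rule dist_triangle)
    also have "\<dots> \<le> norm (s y) + (norm (t 0) + norm (s y))"
      using T.dist_action[OF t, of "s y" 0] norm_triangle_ineq4[of "t 0" "s y"]
      by (simp add: dist_norm add.commute)
    finally have "norm (t y - y) \<le> 2 * B + norm (t 0)" using s(2) by (simp add: dist_norm)
    moreover have "norm (linear_part t y - y) \<le> norm (t y - y) + norm (t 0)"
      using norm_triangle_ineq4[of "t y - y" "t 0"] by (simp add: linear_part_def algebra_simps)
    ultimately show ?thesis by simp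
  qed
  moreover have "linear (\<lambda>y. linear_part t y - y)"
    using linear_linear_part[OF T.isometry[OF t]] by (intro linear_compose_sub linear_ident) auto
  ultimately have "linear_part t x - x = 0" using linear_bounded_imp_zero by blast
  then show ?thesis by (simp add: linear_part_def algebra_simps)
qed

text \<open>Translating a large multiple of a vector orthogonal to all translations can only
  lengthen it, so its orbit would miss every fixed ball, against cocompactness.\<close>

lemma span_translations: "span ((\<lambda>t. t 0) ` T) = UNIV"
proof (rule ccontr)
  assume "span ((\<lambda>t. t 0) ` T) \<noteq> UNIV"
  then obtain a where a: "a \<noteq> 0" "\<And>x. x \<in> span ((\<lambda>t. t 0) ` T) \<Longrightarrow> orthogonal a x"
    using span_not_UNIV_orthogonal by (metis orthogonal_def)
  obtain B where B: "\<And>y. \<exists>t\<in>T. norm (t y) \<le> B" using T_cocompact by blast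
  obtain k :: nat where k: "B < real k * norm a"
    using reals_Archimedean3[of "norm a"] a(1) by auto
  obtain t where t: "t \<in> T" "norm (t (real k *\<^sub>R a)) \<le> B" using B by blast
  have "orthogonal (real k *\<^sub>R a) (t 0)"
    using a(2)[of "t 0"] t(1) by (simp add: span_base orthogonal_clauses)
  then have "(norm (real k *\<^sub>R a + t 0))\<^sup>2 = (norm (real k *\<^sub>R a))\<^sup>2 + (norm (t 0))\<^sup>2"
    by (rule norm_add_Pythagorean)
  then have "norm (real k *\<^sub>R a) \<le> norm (real k *\<^sub>R a + t 0)"
    by (metis abs_norm_cancel le_add_same_cancel1 power2_le_iff_abs_le norm_ge_zero zero_le_power2)
  then show False using k t(2) T_translation[OF t(1), of "real k *\<^sub>R a"] by simp
qed

text \<open>A translation moves all points equally far, so the finite test set for discreteness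
  reduces to the origin.\<close>

lemma T_separated:
  obtains e where "e > 0" "\<And>t. t \<in> T \<Longrightarrow> norm (t 0) < e \<Longrightarrow> t = id"
proof -
  obtain e F where e: "e > 0" "finite F" "\<And>g. g \<in> G \<Longrightarrow> (\<And>x. x \<in> F \<Longrightarrow> dist (g x) x < e) \<Longrightarrow> g = id"
    using discrete_separation[OF discrete] by blast
  have "t = id" if t: "t \<in> T" "norm (t 0) < e" for t
  proof (rule e(3))
    show "t \<in> G" using t T_subset by blast
    show "dist (t x) x < e" for x
      using T_translation[OF t(1), of x] t(2) by (simp add: dist_norm)
  qed
  with e(1) show ?thesis using that by blast
qed

text \<open>The displacement vectors are uniformly separated, because T acts isometrically on them;
  a bounded infinite set of them would have a limit point.\<close>

lemma finite_bounded_T: "finite {t \<in> T. norm (t 0) \<le> r}"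
proof (rule ccontr)
  assume inf: "infinite {t \<in> T. norm (t 0) \<le> r}"
  let ?S = "{t \<in> T. norm (t 0) \<le> r}" and ?f = "\<lambda>t::'e \<Rightarrow> 'e. t 0"
  obtain e where e: "e > 0" "\<And>t. t \<in> T \<Longrightarrow> norm (t 0) < e \<Longrightarrow> t = id" using T_separated by blast
  have sep: "s = t" if st: "s \<in> T" "t \<in> T" "dist (s 0) (t 0) < e" for s t
  proof -
    obtain u where u: "u \<in> T" "u \<circ> t = id" using T.inverse_mem[OF st(2)] by blast
    have "norm ((u \<circ> s) 0) = dist (u (s 0)) (u (t 0))"
      using u(2) by (simp add: fun_eq_iff)
    also have "\<dots> < e" using st(3) T.dist_action[OF u(1)] by simp
    finally have "u \<circ> s = id" using e(2) T.comp_mem[OF u(1) st(1)] by blast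
    then have "u \<circ> s = u \<circ> t" using u(2) by simp
    moreover have "inj u" using T.isometry[OF u(1)] by (simp add: carrier_isometry_group bij_is_inj)
    ultimately show ?thesis by (simp add: fun.inj_map_strong fun_eq_iff inj_eq)
  qed
  have "inj_on ?f ?S" using sep e(1) by (intro inj_onI) auto
  then have "infinite (?f ` ?S)" using inf finite_imageD by blast
  moreover have "bounded (?f ` ?S)" by (auto simp: bounded_iff)
  ultimately obtain x where "x islimpt ?f ` ?S"
    using bounded_infinite_imp_islimpt by blast
  moreover have "\<not> x islimpt ?f ` ?S"
    by (rule discrete_imp_not_islimpt[OF e(1)]) (use sep in auto)
  ultimately show False by simp
qed

text \<open>Proper discontinuity: with g = t X^k, a bound on g x bounds the translation t, for each
  of the finitely many k.\<close>

lemma finite_return: "finite {g \<in> G. dist (g x) y \<le> r}"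
proof -
  let ?S = "\<lambda>k. (\<lambda>t. t \<circ> (X ^^ k)) ` {t \<in> T. norm (t 0) \<le> r + dist ((X ^^ k) x) y}"
  have "{g \<in> G. dist (g x) y \<le> r} \<subseteq> (\<Union>k<M. ?S k)"
  proof
    fix g assume g: "g \<in> {g \<in> G. dist (g x) y \<le> r}"
    then obtain t k where t: "t \<in> T" "k < M" "g = t \<circ> (X ^^ k)" using decomp[of g] by blast
    have "norm (t 0) = dist (g x) ((X ^^ k) x)"
      using T_translation[OF t(1), of "(X ^^ k) x"] t(3) by (simp add: dist_norm)
    also have "\<dots> \<le> r + dist ((X ^^ k) x) y"
      using g dist_triangle[of "g x" "(X ^^ k) x" y] by (simp add: dist_commute)
    finally show "g \<in> (\<Union>k<M. ?S k)" using t by blast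
  qed
  moreover have "finite (\<Union>k<M. ?S k)" using finite_bounded_T by blast
  ultimately show ?thesis by (rule finite_subset)
qed

text \<open>An element with a fixed point has finitely many powers, hence finite order.\<close>

lemma free_action:
  assumes torsion_free: "\<And>f k. f \<in> G \<Longrightarrow> k \<ge> 1 \<Longrightarrow> f ^^ k = id \<Longrightarrow> f = id"
    and g: "g \<in> G" "g x = x"
  shows "g = id"
proof -
  have pow: "g ^^ k \<in> G" for k
    by (induction k) (use id_mem comp_mem[OF g(1)] in \<open>simp_all only: funpow.simps\<close>)
  moreover have "(g ^^ k) x = x" for k
    by (induction k) (use g(2) in auto)
  ultimately have "range (\<lambda>k. g ^^ k) \<subseteq> {f \<in> G. dist (f x) x \<le> 0}" by auto
  then have "finite (range (\<lambda>k. g ^^ k))" using finite_return finite_subset by blast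
  then have "\<not> inj (\<lambda>k. g ^^ k)" using finite_imageD infinite_UNIV_nat by blast
  then obtain a b where ab: "a < b" "g ^^ a = g ^^ b" unfolding inj_def by (metis linorder_neqE_nat)
  have "g ^^ b = g ^^ a \<circ> g ^^ (b - a)"
    using ab(1) by (simp flip: funpow_add)
  moreover have "inj (g ^^ a)" using isometry[OF pow] by (simp add: carrier_isometry_group bij_is_inj)
  ultimately have "g ^^ (b - a) = id"
    using ab(2) by (simp add: fun_eq_iff inj_eq)
  then show ?thesis using torsion_free[OF g(1), of "b - a"] ab(1) by simp
qed

end

section \<open>Kaehler structures on orbit spaces\<close>

text \<open>Directional derivatives of such maps are locally constant, hence again of this kind. The
  class is therefore closed under the recursion defining \<open>differentiable_upto\<close>, and it
  contains all transition maps of the quotient.\<close>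

definition locally_affine_on :: "'a::euclidean_space set \<Rightarrow> ('a \<Rightarrow> 'b::real_normed_vector) \<Rightarrow> bool" where
  "locally_affine_on S f \<longleftrightarrow> (\<forall>x\<in>S. \<exists>L c U. linear L \<and> open U \<and> x \<in> U \<and> (\<forall>y\<in>U. f y = L y + c))"

lemma has_derivative_locally_affine:
  fixes f :: "'a::euclidean_space \<Rightarrow> 'b::real_normed_vector"
  assumes "linear L" "open U" "x \<in> U" "\<And>y. y \<in> U \<Longrightarrow> f y = L y + c"
  shows "(f has_derivative L) (at x)"
proof -
  have "((\<lambda>y. L y + c) has_derivative L) (at x)"
    using assms(1) by (intro has_derivative_add_const bounded_linear_imp_has_derivative)
      (simp add: linear_conv_bounded_linear)
  then show ?thesis
    by (rule has_derivative_transform_within_open[OF _ assms(2,3)]) (simp add: assms(4))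
qed

lemma locally_affine_differentiable_upto:
  assumes "locally_affine_on S f"
  shows "differentiable_upto k S f"
  using assms
proof (induction k arbitrary: f)
  case 0
  have "isCont f x" if "x \<in> S" for x
    using 0 that has_derivative_locally_affine has_derivative_continuous
    unfolding locally_affine_on_def by metis
  then show ?case by (simp add: continuous_at_imp_continuous_on)
next
  case (Suc k)
  have "f differentiable (at x)" if "x \<in> S" for x
    using Suc.prems that has_derivative_locally_affine differentiableI
    unfolding locally_affine_on_def by metis
  moreover have "locally_affine_on S (\<lambda>x. frechet_derivative f (at x) v)" for v
    unfolding locally_affine_on_def
  proof
    fix x assume "x \<in> S"
    then obtain L c U where L: "linear L" "open U" "x \<in> U" "\<And>y. y \<in> U \<Longrightarrow> f y = L y + c"
      using Suc.prems unfolding locally_affine_on_def by metis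
    have "frechet_derivative f (at y) v = 0 + L v" if "y \<in> U" for y
      using frechet_derivative_at[OF has_derivative_locally_affine[OF L(1,2) that L(4)]] by simp
    then show "\<exists>L' c U. linear L' \<and> open U \<and> x \<in> U \<and> (\<forall>y\<in>U. frechet_derivative f (at y) v = L' y + c)"
      using L(2,3) by (intro exI[of _ "\<lambda>_. 0"] exI[of _ "L v"] exI[of _ U]) (auto simp: linear_zero)
  qed
  ultimately show ?case using Suc.IH by simp
qed

lemma smooth_on_locally_affine: "locally_affine_on S f \<Longrightarrow> smooth_on S f"
  by (simp add: smooth_on_def locally_affine_differentiable_upto)

lemma smooth_on_const: "smooth_on S (\<lambda>_. c)"
  by (rule smooth_on_locally_affine)
    (auto simp: locally_affine_on_def intro!: exI[of _ "\<lambda>_. 0"] exI[of _ c] exI[of _ UNIV] linear_zero)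

lemma smooth_on_ident: "smooth_on S (\<lambda>x. x)"
  by (rule smooth_on_locally_affine)
    (auto simp: locally_affine_on_def intro!: exI[of _ "\<lambda>x. x"] exI[of _ 0] exI[of _ UNIV] linear_ident)

section \<open>Parity of the dimension\<close>

lemma even_DIM_complex_structure:
  fixes J :: "'e::euclidean_space \<Rightarrow> 'e"
  assumes J: "linear J" "\<And>u. J (J u) = - u"
  shows "even (DIM('e))"
proof -
  \<comment> \<open>Induction on the codimension of a J-invariant subspace: adjoining x and J x for
    any x outside raises the dimension by exactly two.\<close>
  have "even (DIM('e) - dim S)" if "subspace S" "J ` S \<subseteq> S" for S
    using that
  proof (induction "DIM('e) - dim S" arbitrary: S rule: less_induct)
    case less
    show ?case
    proof (cases "S = UNIV")
      case True
      then show ?thesis by simp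
    next
      case False
      then obtain x where x: "x \<notin> S" by blast
      have sp: "span S = S" using less.prems(1) by simp
      have y: "J x \<notin> span (insert x S)"
      proof
        assume "J x \<in> span (insert x S)"
        then obtain a where a: "J x - a *\<^sub>R x \<in> S"
          unfolding span_insert sp by auto
        \<comment> \<open>Modulo S the vector x would be an eigenvector of J with real eigenvalue a;
          this combination eliminates J x and leaves a nonzero multiple of x in S.\<close>
        have "J (J x - a *\<^sub>R x) + a *\<^sub>R (J x - a *\<^sub>R x) \<in> S"
          using a less.prems by (intro subspace_add subspace_scale) auto
        also have "J (J x - a *\<^sub>R x) + a *\<^sub>R (J x - a *\<^sub>R x) = - ((1 + a * a) *\<^sub>R x)"
          by (simp add: linear_diff[OF J(1)] linear_scale[OF J(1)] J(2) algebra_simps)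
        finally have "(- inverse (1 + a * a)) *\<^sub>R (- ((1 + a * a) *\<^sub>R x)) \<in> S"
          by (rule subspace_scale[OF less.prems(1)])
        moreover have "1 + a * a \<noteq> 0" by (smt (verit) zero_le_square)
        ultimately show False using x by simp
      qed
      define S' where "S' = span (insert (J x) (insert x S))"
      have "x \<notin> span S" using x sp by blast
      then have dim: "dim S' = dim S + 2"
        using y by (simp add: S'_def dim_insert)
      have "J ` S' = span (J ` insert (J x) (insert x S))"
        unfolding S'_def by (simp only: linear_span_image[OF J(1)])
      also have "\<dots> \<subseteq> S'"
      proof (rule span_minimal)
        show "J ` insert (J x) (insert x S) \<subseteq> S'"
          using less.prems(2) unfolding S'_def
          by (auto simp: J(2) span_neg span_base)
      qed (simp add: S'_def)
      finally have inv: "J ` S' \<subseteq> S'" .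
      have sub: "subspace S'" by (simp add: S'_def)
      have le: "dim S' \<le> DIM('e)" by (rule dim_subset_UNIV)
      have "even (DIM('e) - dim S')"
        by (rule less.hyps[OF _ sub inv]) (use dim le in simp)
      moreover have "DIM('e) - dim S = DIM('e) - dim S' + 2" using dim le by simp
      ultimately show ?thesis by simp
    qed
  qed
  from this[of "{0}"] show ?thesis using J(1) by (simp add: linear_0)
qed

lemma kaehler_manifold_even_DIM:
  fixes \<A> :: "('x, 'e::euclidean_space) chart set"
  assumes "kaehler_manifold T \<A>" "topspace T \<noteq> {}"
  shows "even (DIM('e))"
proof -
  obtain J where J: "complex_structure \<A> J" and T: "topspace T = (\<Union>c\<in>\<A>. fst c)"
    using assms(1) unfolding kaehler_manifold_def smooth_manifold_def by blast
  obtain c x where "c \<in> \<A>" "x \<in> fst c" using T assms(2) by blast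
  then have "linear (J c (snd c x))" "\<And>u. J c (snd c x) (J c (snd c x) u) = - u"
    using J unfolding complex_structure_def endomorphism_field_def by blast+
  then show ?thesis by (rule even_DIM_complex_structure)
qed

section \<open>The orbit space of a free, properly discontinuous action as a manifold\<close>

locale free_isometric_action = isometric_action G
  for G :: "('e::euclidean_space \<Rightarrow> 'e) set" +
  assumes finite_return: "\<And>x y r. finite {g \<in> G. dist (g x) y \<le> r}"
    and free: "\<And>g x. g \<in> G \<Longrightarrow> g x = x \<Longrightarrow> g = id"
begin

text \<open>Only finitely many g bring x within distance 1 of y, so the positive distances have a
  minimum. The case of y in another orbit gives the Hausdorff property, the case y = x gives
  charts.\<close>

lemma orbit_separation:
  obtains \<delta> where "\<delta> > 0" "\<And>g. g \<in> G \<Longrightarrow> g x \<noteq> y \<Longrightarrow> \<delta> \<le> dist (g x) y"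
proof -
  define D where "D = (\<lambda>g. dist (g x) y) ` {g \<in> {g \<in> G. dist (g x) y \<le> 1}. g x \<noteq> y}"
  have fin: "finite D" unfolding D_def
    by (intro finite_imageI finite_subset[OF _ finite_return[of x y 1]]) auto
  define \<delta> where "\<delta> = Min (insert 1 D)"
  have "\<delta> > 0" using fin by (auto simp: \<delta>_def D_def)
  moreover have "\<delta> \<le> dist (g x) y" if "g \<in> G" "g x \<noteq> y" for g
  proof (cases "dist (g x) y \<le> 1")
    case True
    then have "dist (g x) y \<in> D" using that by (auto simp: D_def)
    then show ?thesis using fin by (simp add: \<delta>_def)
  next
    case False
    have "\<delta> \<le> 1" using fin by (simp add: \<delta>_def)
    then show ?thesis using False by simp
  qed
  ultimately show ?thesis by (rule that)
qed

lemma Hausdorff_orbit_space: "Hausdorff_space (orbit_space G)"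
  unfolding Hausdorff_space_def
proof (intro allI impI)
  fix a b assume ab: "a \<in> topspace (orbit_space G) \<and> b \<in> topspace (orbit_space G) \<and> a \<noteq> b"
  then obtain x y where xy: "a = orbit_map G x" "b = orbit_map G y" by (auto simp: topspace_orbit_space)
  obtain \<delta> where \<delta>: "\<delta> > 0" "\<And>g. g \<in> G \<Longrightarrow> g x \<noteq> y \<Longrightarrow> \<delta> \<le> dist (g x) y"
    using orbit_separation by blast
  let ?U = "orbit_map G ` ball x (\<delta> / 2)" and ?V = "orbit_map G ` ball y (\<delta> / 2)"
  have "disjnt ?U ?V"
  proof (rule ccontr)
    assume "\<not> disjnt ?U ?V"
    then obtain u v where uv: "u \<in> ball x (\<delta> / 2)" "v \<in> ball y (\<delta> / 2)" "orbit_map G u = orbit_map G v"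
      unfolding disjnt_def by blast
    then obtain g where g: "g \<in> G" "v = g u" by (auto simp: orbit_map_eq_iff)
    have "dist (g x) y \<le> dist (g x) (g u) + dist (g u) y" by (rule dist_triangle)
    also have "\<dots> < \<delta>" using uv g dist_action[OF g(1), of x u] by (simp add: dist_commute)
    finally have "g x = y" using \<delta>(2)[OF g(1)] by fastforce
    then have "a = b" using g(1) xy orbit_map_eq_iff by blast
    with ab show False by blast
  qed
  moreover have "a \<in> ?U" "b \<in> ?V" using xy \<delta>(1) by auto
  ultimately show "\<exists>U V. openin (orbit_space G) U \<and> openin (orbit_space G) V \<and> a \<in> U \<and> b \<in> V \<and> disjnt U V"
    using openin_orbit_image by blast
qed

lemma open_map_orbit_map: "open_map euclidean (orbit_space G) (orbit_map G)"
  by (simp add: open_map_def openin_orbit_image)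

lemma continuous_map_orbit_map: "continuous_map euclidean (orbit_space G) (orbit_map G)"
  by (rule quotient_imp_continuous_map[OF quotient_map_orbit_map])

lemma second_countable_orbit_space: "second_countable (orbit_space G)"
proof (rule second_countable_open_map_image[OF continuous_map_orbit_map open_map_orbit_map])
  show "orbit_map G ` topspace euclidean = topspace (orbit_space G)"
    by (simp add: topspace_orbit_space)
  obtain \<B> :: "'e set set" where "countable \<B>" "\<And>C. C \<in> \<B> \<Longrightarrow> open C"
    "\<And>S. open S \<Longrightarrow> \<exists>U. U \<subseteq> \<B> \<and> S = \<Union>U"
    using univ_second_countable by blast
  then show "second_countable (euclidean :: 'e topology)"
    unfolding second_countable_def by (intro exI[of _ \<B>]) (simp, blast)
qed

lemma chart_image_orbit_chart:
  assumes "inj_on (orbit_map G) V"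
  shows "inv_into V (orbit_map G) ` (orbit_map G ` V) = V"
  using assms by (simp add: inv_into_image_cancel)

lemma is_chart_orbit_charts:
  assumes "c \<in> orbit_charts G"
  shows "is_chart (orbit_space G) c"
proof -
  let ?p = "orbit_map G"
  obtain V where V: "open V" "inj_on ?p V" "c = (?p ` V, inv_into V ?p)"
    using assms by (auto simp: orbit_charts_def)
  let ?S = "subtopology (orbit_space G) (?p ` V)"
  have "homeomorphic_map (top_of_set V) ?S ?p"
  proof (rule bijective_open_imp_homeomorphic_map)
    show "continuous_map (top_of_set V) ?S ?p"
      using continuous_map_orbit_map by (auto simp: continuous_map_in_subtopology intro: continuous_map_from_subtopology)
    show "open_map (top_of_set V) ?S ?p"
      using V(1) open_map_orbit_map
      by (intro open_map_into_subtopology open_map_from_subtopology) auto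
    show "?p ` topspace (top_of_set V) = topspace ?S"
      by (auto simp: topspace_orbit_space)
  qed (use V(2) in simp)
  then obtain q where q: "homeomorphic_maps (top_of_set V) ?S ?p q"
    by (auto simp: homeomorphic_map_maps)
  then have "homeomorphic_map ?S (top_of_set V) q"
    using homeomorphic_map_maps homeomorphic_maps_sym by blast
  moreover have "q z = inv_into V ?p z" if "z \<in> topspace ?S" for z
    using that q V(2) unfolding homeomorphic_maps_def by auto
  ultimately have "homeomorphic_map ?S (top_of_set V) (inv_into V ?p)"
    by (rule homeomorphic_map_eq)
  then show ?thesis
    using V openin_orbit_image[OF V(1)] by (simp add: is_chart_def chart_image_orbit_chart)
qed

lemma topspace_orbit_charts: "topspace (orbit_space G) = (\<Union>c\<in>orbit_charts G. fst c)"
proof (intro equalityI subsetI)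
  fix a assume "a \<in> topspace (orbit_space G)"
  then obtain x where x: "a = orbit_map G x" by (auto simp: topspace_orbit_space)
  obtain \<delta> where \<delta>: "\<delta> > 0" "\<And>g. g \<in> G \<Longrightarrow> g x \<noteq> x \<Longrightarrow> \<delta> \<le> dist (g x) x"
    using orbit_separation by blast
  \<comment> \<open>If g maps one point of this ball to another, it moves the centre by less than
    \<delta>; so it fixes the centre and is the identity by freeness.\<close>
  let ?V = "ball x (\<delta> / 2)"
  have "inj_on (orbit_map G) ?V"
  proof (rule inj_onI)
    fix u v assume uv: "u \<in> ?V" "v \<in> ?V" "orbit_map G u = orbit_map G v"
    then obtain g where g: "g \<in> G" "v = g u" by (auto simp: orbit_map_eq_iff)
    have "dist (g x) x \<le> dist (g x) (g u) + dist (g u) x" by (rule dist_triangle)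
    also have "\<dots> < \<delta>" using uv g dist_action[OF g(1), of x u] by (simp add: dist_commute)
    finally have "g x = x" using \<delta>(2)[OF g(1)] by fastforce
    then have "g = id" by (rule free[OF g(1)])
    then show "u = v" using g(2) by simp
  qed
  then have "(orbit_map G ` ?V, inv_into ?V (orbit_map G)) \<in> orbit_charts G"
    unfolding orbit_charts_def by blast
  moreover have "a \<in> orbit_map G ` ?V" using x \<delta>(1) by auto
  ultimately show "a \<in> (\<Union>c\<in>orbit_charts G. fst c)" by force
qed (auto simp: orbit_charts_def topspace_orbit_space)

text \<open>Two points over the same orbit differ by a group element, and injectivity of the
  projection on the target chart forces the same element on a whole neighbourhood. Changes of
  coordinates are thus locally isometries from G.\<close>

lemma transition_orbit_charts:
  assumes "c \<in> orbit_charts G" "d \<in> orbit_charts G" "y \<in> overlap c d"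
  obtains g U where "g \<in> G" "open U" "y \<in> U" "\<And>z. z \<in> U \<Longrightarrow> transition c d z = g z"
proof -
  let ?p = "orbit_map G"
  obtain V where V: "open V" "inj_on ?p V" "c = (?p ` V, inv_into V ?p)"
    using assms(1) by (auto simp: orbit_charts_def)
  obtain W where W: "open W" "inj_on ?p W" "d = (?p ` W, inv_into W ?p)"
    using assms(2) by (auto simp: orbit_charts_def)
  have inv: "inv_into (?p ` V) (inv_into V ?p) z = ?p z" if "z \<in> V" for z
  proof -
    have "inv_into V ?p (?p z) = z" using V(2) that by simp
    moreover have "inj_on (inv_into V ?p) (?p ` V)" by (simp add: inj_on_inv_into)
    ultimately show ?thesis using inv_into_f_f[of "inv_into V ?p" "?p ` V" "?p z"] that by simp
  qed
  obtain a where "a \<in> ?p ` V" "a \<in> ?p ` W" "y = inv_into V ?p a"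
    using assms(3) V W by (auto simp: overlap_def)
  then obtain w where y: "y \<in> V" "w \<in> W" "?p y = ?p w"
    by (metis f_inv_into_f imageE inv_into_into)
  obtain g where g: "g \<in> G" "w = g y" using y(3) by (auto simp: orbit_map_eq_iff)
  \<comment> \<open>Inside V, and mapped by g into W: here the inverse branch over W must return g
    z.\<close>
  define U where "U = V \<inter> g -` W"
  have "open (g -` W)"
    using W(1) continuous_action[OF g(1)] by (simp add: continuous_on_eq_continuous_within continuous_open_vimage open_vimage)
  then have "open U" using V(1) by (simp add: U_def open_Int)
  moreover have "y \<in> U" using y g by (simp add: U_def)
  moreover have "transition c d z = g z" if "z \<in> U" for z
  proof -
    have z: "z \<in> V" "g z \<in> W" using that by (auto simp: U_def)
    have "?p z = ?p (g z)" using g(1) orbit_map_eq_iff by blast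
    then have "transition c d z = inv_into W ?p (?p (g z))"
      using inv[OF z(1)] by (simp add: transition_def V(3) W(3))
    then show ?thesis using W(2) z(2) by simp
  qed
  ultimately show ?thesis using that g(1) by blast
qed

lemma locally_affine_transition:
  assumes "c \<in> orbit_charts G" "d \<in> orbit_charts G"
  shows "locally_affine_on (overlap c d) (transition c d)"
  unfolding locally_affine_on_def
proof
  fix y assume "y \<in> overlap c d"
  from transition_orbit_charts[OF assms this]
  obtain g U where g: "g \<in> G" "open U" "y \<in> U" "\<And>z. z \<in> U \<Longrightarrow> transition c d z = g z" by blast
  then have "\<forall>z\<in>U. transition c d z = linear_part g z + g 0"
    by (simp add: linear_part_def)
  then show "\<exists>L e U. linear L \<and> open U \<and> y \<in> U \<and> (\<forall>z\<in>U. transition c d z = L z + e)"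
    using g linear_linear_part[OF isometry[OF g(1)]] by blast
qed

lemma transition_deriv_orbit_charts:
  assumes "c \<in> orbit_charts G" "d \<in> orbit_charts G" "y \<in> overlap c d"
  obtains g where "g \<in> G" "transition_deriv c d y = linear_part g"
proof -
  obtain g U where g: "g \<in> G" "open U" "y \<in> U" "\<And>z. z \<in> U \<Longrightarrow> transition c d z = g z"
    using transition_orbit_charts[OF assms] by blast
  have "(transition c d has_derivative linear_part g) (at y)"
    using has_derivative_locally_affine[OF linear_linear_part[OF isometry[OF g(1)]] g(2,3), of "transition c d" "g 0"]
      g(4) by (simp add: linear_part_def)
  then show ?thesis using that[OF g(1)] frechet_derivative_at by metis
qed

lemma smooth_manifold_orbit_space: "smooth_manifold (orbit_space G) (orbit_charts G)"
  unfolding smooth_manifold_def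
  using Hausdorff_orbit_space second_countable_orbit_space is_chart_orbit_charts topspace_orbit_charts
    smooth_on_locally_affine locally_affine_transition by blast

text \<open>
  Averaging the Euclidean inner product over \<open>K\<close> makes \<open>K\<close> orthogonal; since the linear parts are
  orthogonal and commute with \<open>K\<close>, all three constant tensors descend to the quotient.
\<close>

theorem kaehler_manifold_orbit_space:
  assumes K: "linear K" "\<And>u. K (K u) = - u"
    and K_commute: "\<And>g u. g \<in> G \<Longrightarrow> K (linear_part g u) = linear_part g (K u)"
  shows "kaehler_manifold (orbit_space G) (orbit_charts G)"
proof -
  define B where "B u v = u \<bullet> v + K u \<bullet> K v" for u v :: 'e
  have B_sym: "B u v = B v u" for u v by (simp add: B_def inner_commute)
  have B_K: "B (K u) (K v) = B u v" for u v by (simp add: B_def K(2))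
  have B_skew: "B (K u) v = - B (K v) u" for u v
    using B_K[of "K u" v] B_sym by (simp add: B_def K(2) inner_commute)
  have B_pos: "B u u > 0" if "u \<noteq> 0" for u
    using that by (simp add: B_def add_pos_nonneg)
  have B_bilinear: "bilinear B"
    unfolding bilinear_def B_def
    by (auto intro!: linearI simp: linear_add[OF K(1)] linear_scale[OF K(1)] inner_simps algebra_simps)
  then have \<omega>_bilinear: "bilinear (\<lambda>u v. B (K u) v)"
    using linear_compose[OF K(1)] unfolding bilinear_def o_def by blast
  have B_inv: "B (linear_part g u) (linear_part g v) = B u v" if "g \<in> G" for g u v
    using orthogonal_linear_part[OF isometry[OF that]] K_commute[OF that]
    by (simp add: B_def orthogonal_transformation_def)
  \<comment> \<open>For a constant tensor the transformation law is exactly invariance under the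
    linear parts of G.\<close>
  have tensor: "covariant_2_tensor (orbit_charts G) (\<lambda>_ _. t)"
    if "bilinear t" "\<And>g u v. g \<in> G \<Longrightarrow> t (linear_part g u) (linear_part g v) = t u v" for t
    unfolding covariant_2_tensor_def
  proof (intro conjI ballI allI)
    fix c d y u v assume "c \<in> orbit_charts G" "d \<in> orbit_charts G" "y \<in> overlap c d"
    then obtain g where "g \<in> G" "transition_deriv c d y = linear_part g"
      by (rule transition_deriv_orbit_charts)
    with that(2) show "t u v = t (transition_deriv c d y u) (transition_deriv c d y v)" by simp
  qed (use that(1) smooth_on_const in auto)
  have "riemannian_metric (orbit_charts G) (\<lambda>_ _. B)"
    unfolding riemannian_metric_def using tensor[OF B_bilinear B_inv] B_sym B_pos by blast
  moreover have "symplectic_structure (orbit_charts G) (\<lambda>_ _ u v. B (K u) v)"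
    unfolding symplectic_structure_def
  proof (intro conjI ballI allI impI)
    show "covariant_2_tensor (orbit_charts G) (\<lambda>_ _ u v. B (K u) v)"
      by (rule tensor[OF \<omega>_bilinear]) (simp add: K_commute B_inv)
    show "B (K u) v = - B (K v) u" for u v by (rule B_skew)
    show "u = 0" if "\<forall>v. B (K u) v = 0" for u
    proof (rule ccontr)
      assume "u \<noteq> 0"
      then have "B (K u) (K u) > 0" using B_K[of u u] B_pos by simp
      with that show False by simp
    qed
  \<comment> \<open>The remaining goal is closedness; the coefficients are constant, so all
    derivatives vanish.\<close>
  qed simp
  moreover have "complex_structure (orbit_charts G) (\<lambda>_ _. K)"
    unfolding complex_structure_def
  proof (intro conjI ballI allI)
    show "endomorphism_field (orbit_charts G) (\<lambda>_ _. K)"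
      unfolding endomorphism_field_def
    proof (intro conjI ballI allI)
      fix c d y u assume "c \<in> orbit_charts G" "d \<in> orbit_charts G" "y \<in> overlap c d"
      then obtain g where "g \<in> G" "transition_deriv c d y = linear_part g"
        by (rule transition_deriv_orbit_charts)
      with K_commute show "transition_deriv c d y (K u) = K (transition_deriv c d y u)" by simp
    qed (use K(1) smooth_on_const in auto)
    show "K (K u) = - u" for u by (rule K(2))
    fix c :: "('e set, 'e) chart" and y assume c: "c \<in> orbit_charts G" and y: "y \<in> chart_image c"
    \<comment> \<open>K is constant in every chart, so the given coordinates are already
      holomorphic: h and k are the identity and J0 is K.\<close>
    have "open (chart_image c)" using is_chart_orbit_charts[OF c] by (simp add: is_chart_def)
    then show "\<exists>W (h :: 'e \<Rightarrow> 'e) k J0.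
        open W \<and> y \<in> W \<and> W \<subseteq> chart_image c \<and> open (h ` W) \<and>
        smooth_on W h \<and> smooth_on (h ` W) k \<and> (\<forall>z\<in>W. k (h z) = z) \<and> linear J0 \<and>
        (\<forall>z\<in>W. \<forall>u. frechet_derivative h (at z) (K u) = J0 (frechet_derivative h (at z) u))"
      using y K(1) smooth_on_ident
      by (intro exI[of _ "chart_image c"] exI[of _ "\<lambda>x. x"] exI[of _ K]) (auto simp: frechet_derivative_ident)
  qed
  ultimately show ?thesis
    unfolding kaehler_manifold_def
    using smooth_manifold_orbit_space B_K
    by (intro conjI exI[of _ "\<lambda>_ _. B"] exI[of _ "\<lambda>_ _. K"] exI[of _ "\<lambda>_ _ u v. B (K u) v"]) auto
qed

end

section \<open>The holonomy representation\<close>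

text \<open>By counting, the spanning vectors form a basis on which R acts as 2u copies of the
  regular representation of Z_n. K sends copy 2e to copy 2e + 1 and returns with a minus sign; since
  it leaves the exponent k alone, it commutes with R.\<close>

lemma commuting_complex_structure:
  fixes R :: "'e::euclidean_space \<Rightarrow> 'e" and b :: "nat \<Rightarrow> 'e"
  assumes R: "linear R" "R ^^ n = id"
    and spanning: "span {(R ^^ k) (b d) | k d. k < n \<and> d < 2 * u} = UNIV"
    and dim: "DIM('e) = n * (2 * u)"
  obtains K where "linear K" "\<And>x. K (K x) = - x" "\<And>x. K (R x) = R (K x)"
proof -
  define w where "w = (\<lambda>(k, d). (R ^^ k) (b d))"
  define I where "I = {..<n} \<times> {..<2 * u}"
  have wI: "w ` I = {(R ^^ k) (b d) | k d. k < n \<and> d < 2 * u}"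
    by (auto simp: w_def I_def)
  have fin: "finite I" and card: "card I = DIM('e)" by (simp_all add: I_def dim)
  have le: "card (w ` I) \<le> DIM('e)" using card_image_le[OF fin, of w] card by simp
  have ind: "independent (w ` I)"
    by (rule card_le_dim_spanning[of _ UNIV]) (use spanning wI finite_imageI[OF fin, of w] le in auto)
  \<comment> \<open>Counting also shows that distinct indices give distinct vectors, so K may be
    prescribed through the index pair.\<close>
  have "DIM('e) \<le> card (w ` I)"
    using dim_le_card[of UNIV "w ` I"] spanning wI finite_imageI[OF fin, of w] by simp
  then have inj: "inj_on w I" using le card fin by (intro eq_card_imp_inj_on) auto
  define s where "s d = (if even d then 1 else - 1 :: real)" for d :: nat
  define d' where "d' d = (if even d then d + 1 else d - 1)" for d :: nat
  have d': "d' d < 2 * u" "d' (d' d) = d" "s (d' d) = - s d" if "d < 2 * u" for d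
    using that by (auto simp: d'_def s_def elim!: oddE evenE)
  have s: "s d * s d = 1" for d by (simp add: s_def)
  define f where "f x = (case inv_into I w x of (k, d) \<Rightarrow> s d *\<^sub>R w (k, d' d))" for x
  obtain K where K: "linear K" "\<And>x. x \<in> w ` I \<Longrightarrow> K x = f x"
    using linear_independent_extend[OF ind, of f] by auto
  \<comment> \<open>The exponent k = n is included, where R^n = id wraps around to k = 0;
    commutation with R at k = n - 1 needs it.\<close>
  have Kw: "K ((R ^^ k) (b d)) = s d *\<^sub>R (R ^^ k) (b (d' d))" if "k \<le> n" "d < 2 * u" for k d
  proof -
    have lt: "K ((R ^^ k) (b d)) = s d *\<^sub>R (R ^^ k) (b (d' d))" if "k < n" for k
    proof -
      have "(k, d) \<in> I" using that \<open>d < 2 * u\<close> by (simp add: I_def)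
      then show ?thesis
        using K(2)[of "w (k, d)"] inj by (simp add: f_def) (simp add: w_def)
    qed
    have "n > 0" using dim DIM_positive[where 'a = 'e] by (cases n) auto
    then show ?thesis using lt[of k] lt[of 0] that(1) R(2) by (cases "k = n") auto
  qed
  have on_span: "g x = h x" if "linear g" "linear h" "\<And>k d. k < n \<Longrightarrow> d < 2 * u \<Longrightarrow> g ((R ^^ k) (b d)) = h ((R ^^ k) (b d))"
    for g h :: "'e \<Rightarrow> 'e" and x
    by (rule linear_eq_on[OF that(1,2), of x "{(R ^^ k) (b d) | k d. k < n \<and> d < 2 * u}"])
      (use spanning that(3) in auto)
  have "(K \<circ> K) x = - x" for x
  proof (rule on_span[of "K \<circ> K" "\<lambda>x. - x"])
    show "linear (K \<circ> K)" by (rule linear_compose[OF K(1) K(1)])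
    show "linear (\<lambda>x :: 'e. - x)" by (rule linear_uminus)
    fix k d assume "k < n" "d < 2 * u"
    then show "(K \<circ> K) ((R ^^ k) (b d)) = - (R ^^ k) (b d)"
      using d'[of d] Kw[of k d] Kw[of k "d' d"] s[of d] by (simp add: linear_scale[OF K(1)])
  qed
  moreover have "(K \<circ> R) x = (R \<circ> K) x" for x
  proof (rule on_span[of "K \<circ> R" "R \<circ> K"])
    show "linear (K \<circ> R)" "linear (R \<circ> K)"
      using linear_compose K(1) R(1) by blast+
    fix k d assume "k < n" "d < 2 * u"
    then show "(K \<circ> R) ((R ^^ k) (b d)) = (R \<circ> K) ((R ^^ k) (b d))"
      using Kw[of k d] Kw[of "Suc k" d] by (simp add: linear_scale[OF R(1)])
  qed
  ultimately show ?thesis using that[OF K(1)] by simp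
qed

text \<open>This is i - k modulo n with residues taken in 1, ..., n; the value n occurs at k = i,
  and adding n first avoids truncated subtraction.\<close>

lemma word_perm_gamma_word_pow:
  assumes "2 \<le> n" "1 \<le> i" "i \<le> n" "k \<le> n"
  shows "(word_perm (gamma_word n) ^^ k) i = (if k < i then i - k else n + i - k)"
  using assms(4)
proof (induction k)
  case (Suc k)
  then show ?case
    using assms(1-3) by (auto simp: word_perm_gamma_word[OF assms(1)])
qed (use assms in simp)

text \<open>The bridge from algebra to geometry. \<open>v i j\<close> is the translation vector of
  the image of A_ij^n and \<open>R\<close> the linear part of the image of x; conjugation by x in
  the braid quotient becomes the action of R on these vectors.\<close>

lemma Gamma_action:
  fixes G :: "('e::euclidean_space \<Rightarrow> 'e) set"
  assumes n: "2 \<le> n" and G: "bieberbach_group G"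
    and iso: "Gamma_group n \<cong> isometry_group \<lparr> carrier := G \<rparr>"
  obtains R :: "'e \<Rightarrow> 'e" and v :: "nat \<Rightarrow> nat \<Rightarrow> 'e" where
    "free_isometric_action G" "linear R"
    "\<And>g. g \<in> G \<Longrightarrow> \<exists>k. linear_part g = R ^^ k"
    "span {v i j | i j. i \<in> {1..n} \<and> j \<in> {1..n} \<and> i \<noteq> j} = UNIV"
    "\<And>i j. i \<in> {1..n} \<Longrightarrow> j \<in> {1..n} \<Longrightarrow> i \<noteq> j \<Longrightarrow>
       R (v i j) = v (word_perm (gamma_word n) i) (word_perm (gamma_word n) j)"
    "\<And>i j. v i j = v j i"
proof -
  let ?Q = "braid_quotient n" and ?S = "Gamma_set n"
  interpret Q: group ?Q by (rule group_braid_quotient)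
  define H where "H = generate ?Q (A_powers n n)"
  define x where "x = quotient_class n (gamma_word n)"
  have x: "x \<in> carrier ?Q" using gamma_word[OF n] by (simp add: x_def)
  have gens: "insert x (A_powers n n) \<subseteq> carrier ?Q" using x A_powers_closed by blast
  have S: "?S = generate ?Q (insert x (A_powers n n))" by (simp add: Gamma_set_eq[OF n] x_def)
  have S_sub: "subgroup ?S ?Q" unfolding S by (rule Q.generate_is_subgroup[OF gens])
  have HS: "H \<subseteq> ?S" unfolding H_def S by (rule Q.mono_generate) blast
  have xS: "x \<in> ?S" unfolding S by (rule generate.incl) simp
  have H_sub: "subgroup H ?Q" unfolding H_def by (rule Q.generate_is_subgroup[OF A_powers_closed])
  obtain \<phi> where "\<phi> \<in> iso (Gamma_group n) (isometry_group \<lparr> carrier := G \<rparr>)"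
    using iso by (auto simp: is_iso_def)
  then have \<phi>_hom: "\<phi> \<in> hom (Gamma_group n) (isometry_group \<lparr> carrier := G \<rparr>)"
    and \<phi>_img: "\<phi> ` ?S = G"
    by (auto simp: iso_def bij_betw_def Gamma_group_def)
  have mult: "\<phi> (a \<otimes>\<^bsub>?Q\<^esub> c) = \<phi> a \<circ> \<phi> c" if "a \<in> ?S" "c \<in> ?S" for a c
    using \<phi>_hom that by (simp add: hom_def Gamma_group_def isometry_group_def)
  have crys: "subgroup G isometry_group" "discrete G" "compact_space (orbit_space G)"
    using G by (auto simp: bieberbach_group_def crystallographic_group_def)
  interpret isometric_action G by (rule isometric_action.intro) (rule crys)
  interpret \<phi>: group_hom "?Q \<lparr> carrier := ?S \<rparr>" "isometry_group :: ('e \<Rightarrow> 'e) monoid" \<phi>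
  proof (intro group_hom.intro group_hom_axioms.intro homI)
    show "group (?Q \<lparr> carrier := ?S \<rparr>)" by (rule Q.subgroup_imp_group[OF S_sub])
    show "group (isometry_group :: ('e \<Rightarrow> 'e) monoid)" by (rule group_isometry_group)
  qed (use \<phi>_img isometry mult in auto)
  have \<phi>_one: "\<phi> \<one>\<^bsub>?Q\<^esub> = id" using \<phi>.hom_one by simp
  have \<phi>_pow: "\<phi> (x [^]\<^bsub>?Q\<^esub> (k::nat)) = \<phi> x ^^ k" for k
  proof (induction k)
    case (Suc k)
    have "x [^]\<^bsub>?Q\<^esub> k \<in> ?S"
      by (induction k) (use xS subgroup.m_closed[OF S_sub] subgroup.one_closed[OF S_sub] in auto)
    then show ?case using Suc mult[OF _ xS] by (simp add: funpow_swap1 fun_eq_iff)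
  qed (simp add: \<phi>_one)
  define T where "T = \<phi> ` H"
  interpret virtually_abelian_action G T "\<phi> x" "n * n"
  proof (intro virtually_abelian_action.intro virtually_abelian_action_axioms.intro)
    show "isometric_action G" by (rule isometric_action_axioms)
    show "compact_space (orbit_space G)" "discrete G" using crys by blast+
    show "subgroup T isometry_group"
      unfolding T_def
      by (rule \<phi>.subgroup_img_is_subgroup) (rule Q.subgroup_incl[OF H_sub S_sub HS])
    show "T \<subseteq> G" unfolding T_def using HS \<phi>_img by blast
    show "\<phi> x \<in> G" using xS \<phi>_img by blast
    fix s t assume "s \<in> T" "t \<in> T"
    then obtain a c where a: "a \<in> H" "s = \<phi> a" and c: "c \<in> H" "t = \<phi> c" by (auto simp: T_def)
    then have "a \<otimes>\<^bsub>?Q\<^esub> c = c \<otimes>\<^bsub>?Q\<^esub> a"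
      using generate_A_powers_pure pure_classes_commute unfolding H_def by blast
    then show "s \<circ> t = t \<circ> s" using mult[of a c] mult[of c a] a c subsetD[OF HS] by auto
  next
    fix g assume "g \<in> G"
    then obtain \<gamma> where \<gamma>: "\<gamma> \<in> ?S" "g = \<phi> \<gamma>" using \<phi>_img by blast
    obtain h r where h: "h \<in> H" "r < n * n" "\<gamma> = h \<otimes>\<^bsub>?Q\<^esub> x [^]\<^bsub>?Q\<^esub> (r::nat)"
      using Gamma_set_decomp[OF n \<gamma>(1)] unfolding H_def x_def by blast
    have "x [^]\<^bsub>?Q\<^esub> r \<in> ?S"
      by (induction r) (use xS subgroup.m_closed[OF S_sub] subgroup.one_closed[OF S_sub] in auto)
    then have "g = \<phi> h \<circ> (\<phi> x ^^ r)" using mult[of h] h HS \<phi>_pow \<gamma>(2) by auto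
    then show "\<exists>t\<in>T. \<exists>r<n * n. g = t \<circ> (\<phi> x ^^ r)" using h by (auto simp: T_def)
  qed
  have free: "free_isometric_action G"
  proof unfold_locales
    show "finite {g \<in> G. dist (g x) y \<le> r}" for x y r by (rule finite_return)
    show "g = id" if "g \<in> G" "g x = x" for g x
      by (rule free_action[OF _ that]) (use G in \<open>auto simp: bieberbach_group_def\<close>)
  qed
  define a where "a i j = A_sym n i j [^]\<^bsub>?Q\<^esub> n" for i j
  define v where "v i j = \<phi> (a i j) 0" for i j
  define R where "R = linear_part (\<phi> x)"
  let ?V = "{v i j | i j. i \<in> {1..n} \<and> j \<in> {1..n} \<and> i \<noteq> j}"
  have aH: "a i j \<in> H" if "i \<in> {1..n}" "j \<in> {1..n}" "i \<noteq> j" for i j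
    unfolding H_def by (rule generate.incl) (use that in \<open>auto simp: A_powers_sym a_def\<close>)
  have TH: "\<phi> h \<in> T" if "h \<in> H" for h using that by (simp add: T_def)
  have R: "linear R" unfolding R_def by (rule linear_linear_part[OF isometry[OF X_mem]])
  \<comment> \<open>H acts by translations, so h |-> \<phi> h 0 is additive on H and its values are
    generated by those on the A_ij^n.\<close>
  have span_h: "\<phi> h 0 \<in> span ?V" if "h \<in> H" for h
    using that unfolding H_def
  proof (induction rule: generate.induct)
    case one
    then show ?case by (simp add: \<phi>_one span_zero)
  next
    case (incl h)
    then show ?case unfolding A_powers_sym v_def a_def by (intro span_base) blast
  next
    case (inv h)
    then have hH: "h \<in> H" "inv\<^bsub>?Q\<^esub> h \<in> H"
      unfolding H_def by (auto intro: generate.incl generate.inv)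
    have "inv\<^bsub>?Q\<^esub> h \<otimes>\<^bsub>?Q\<^esub> h = \<one>\<^bsub>?Q\<^esub>" using hH H_sub by (intro Q.l_inv) (blast dest: subgroup.mem_carrier)
    then have "\<phi> (inv\<^bsub>?Q\<^esub> h) \<circ> \<phi> h = id" using mult[of "inv\<^bsub>?Q\<^esub> h" h] hH subsetD[OF HS] \<phi>_one by auto
    then have "\<phi> (inv\<^bsub>?Q\<^esub> h) (\<phi> h 0) = 0" by (simp add: fun_eq_iff)
    then have "\<phi> (inv\<^bsub>?Q\<^esub> h) 0 = - \<phi> h 0"
      using T_translation[OF TH[OF hH(2)], of "\<phi> h 0"] by (simp add: eq_neg_iff_add_eq_0 add.commute)
    moreover have "\<phi> h 0 \<in> span ?V"
      using inv unfolding A_powers_sym v_def a_def by (intro span_base) blast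
    ultimately show ?case by (simp add: span_neg)
  next
    case (eng h1 h2)
    then have hH: "h1 \<in> H" "h2 \<in> H" by (simp_all add: H_def)
    then have "\<phi> (h1 \<otimes>\<^bsub>?Q\<^esub> h2) 0 = \<phi> h2 0 + \<phi> h1 0"
      using mult[of h1 h2] subsetD[OF HS] T_translation[OF TH[OF hH(1)], of "\<phi> h2 0"] by auto
    then show ?case using eng by (simp add: span_add)
  qed
  have "span ?V = UNIV"
  proof -
    have "(\<lambda>t. t 0) ` T \<subseteq> span ?V" using span_h by (auto simp: T_def)
    then have "span ((\<lambda>t. t 0) ` T) \<subseteq> span ?V" by (rule span_minimal) simp
    then show ?thesis using span_translations by auto
  qed
  moreover have "R (v i j) = v (word_perm (gamma_word n) i) (word_perm (gamma_word n) j)"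
    if ij: "i \<in> {1..n}" "j \<in> {1..n}" "i \<noteq> j" for i j
  proof -
    let ?c = "word_perm (gamma_word n)"
    have p: "?c permutes {1..n}" by (rule word_perm_permutes[OF gamma_word[OF n]])
    have cij: "?c i \<in> {1..n}" "?c j \<in> {1..n}" "?c i \<noteq> ?c j"
      using ij permutes_in_image[OF p] inj_eq[OF permutes_inj[OF p]] by auto
    have A: "A_sym n i j \<in> carrier ?Q" using A_sym_pure[OF ij] by (rule pure_classes_closed)
    have "conj_by n (gamma_word n) (a i j) = a (?c i) (?c j)"
      unfolding a_def using conj_by_A_sym[OF gamma_word[OF n] ij] conj_by_pow[OF gamma_word[OF n] A] by simp
    moreover have "a i j \<in> carrier ?Q" using A by (simp add: a_def)
    moreover from this have "x \<otimes>\<^bsub>?Q\<^esub> a i j = conj_by n (gamma_word n) (a i j) \<otimes>\<^bsub>?Q\<^esub> x"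
      using x by (simp add: conj_by_def x_def[symmetric] Q.m_assoc)
    ultimately have "x \<otimes>\<^bsub>?Q\<^esub> a i j = a (?c i) (?c j) \<otimes>\<^bsub>?Q\<^esub> x" by simp
    then have "\<phi> x \<circ> \<phi> (a i j) = \<phi> (a (?c i) (?c j)) \<circ> \<phi> x"
      using mult[of x "a i j"] mult[of "a (?c i) (?c j)" x] xS
        subsetD[OF HS aH[OF ij]] subsetD[OF HS aH[OF cij]] by simp
    \<comment> \<open>The conjugation relation evaluated at the origin; subtracting \<phi> x 0 turns
      the affine map into its linear part.\<close>
    then have "\<phi> x (v i j) = \<phi> (a (?c i) (?c j)) (\<phi> x 0)" by (simp add: v_def fun_eq_iff)
    also have "\<dots> = \<phi> x 0 + v (?c i) (?c j)"
      unfolding v_def by (rule T_translation[OF TH[OF aH[OF cij]]])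
    finally show ?thesis by (simp add: R_def linear_part_def)
  qed
  moreover have "\<exists>k. linear_part g = R ^^ k" if g: "g \<in> G" for g
  proof -
    obtain t r where t: "t \<in> T" "g = t \<circ> (\<phi> x ^^ r)" using decomp[OF g] by blast
    \<comment> \<open>Translations have trivial linear part, so only the power of x
      contributes.\<close>
    have "t y - t 0 = y" for y
      using T_translation[OF t(1), of y] by simp
    then have "linear_part t = id"
      by (simp add: linear_part_def fun_eq_iff)
    moreover have "linear_part (\<phi> x ^^ k) = R ^^ k" for k
    proof (induction k)
      case 0
      then show ?case by (auto simp: linear_part_def)
    next
      case (Suc k)
      then show ?case
        using linear_part_comp[OF isometry[OF X_mem], of "\<phi> x ^^ k"] by (simp only: R_def funpow.simps)
    qed
    ultimately have "linear_part g = R ^^ r"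
      using linear_part_comp[OF T.isometry[OF t(1)], of "\<phi> x ^^ r"] t(2) by simp
    then show ?thesis by blast
  qed
  moreover have "v i j = v j i" for i j
    by (simp add: v_def a_def A_sym_def min.commute max.commute)
  ultimately show ?thesis using that[OF free R] by blast
qed

theorem theorem3:
  fixes p r :: nat and G :: "('e::euclidean_space \<Rightarrow> 'e) set"
  assumes "prime p" and "odd p" and "r \<ge> 1"
    and "DIM('e) = p ^ r * (p ^ r - 1) div 2"
    and "bieberbach_group G"
    and "Gamma_group (p ^ r) \<cong> isometry_group \<lparr> carrier := G \<rparr>"
  shows "kaehler_manifold (orbit_space G) (orbit_charts G) \<longleftrightarrow> (\<exists>u::nat. u \<ge> 1 \<and> p ^ r = 4 * u + 1)"
proof -
  define n where "n = p ^ r"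
  have "odd n" using assms(2) by (simp add: n_def)
  moreover have "p ^ 1 \<le> p ^ r" using assms(3) prime_gt_0_nat[OF assms(1)] by (intro power_increasing) auto
  then have "n \<ge> 2" using prime_ge_2_nat[OF assms(1)] by (simp add: n_def)
  ultimately obtain m where m: "n = 2 * m + 1" "m \<ge> 1" by (auto elim!: oddE)
  have dim: "DIM('e) = n * m" using assms(4) m by (simp add: n_def[symmetric])
  note iso = assms(6)[folded n_def]
  show ?thesis
    unfolding n_def[symmetric]
  proof
    assume "kaehler_manifold (orbit_space G) (orbit_charts G)"
    then have "even (DIM('e))"
      by (rule kaehler_manifold_even_DIM) (simp add: topspace_orbit_space)
    \<comment> \<open>As n is odd, the parity of n * m is that of m.\<close>
    then obtain u where "m = 2 * u" using dim m(1) by (auto elim!: evenE)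
    then show "\<exists>u::nat. u \<ge> 1 \<and> n = 4 * u + 1" using m by (intro exI[of _ u]) auto
  next
    assume "\<exists>u::nat. u \<ge> 1 \<and> n = 4 * u + 1"
    then obtain u where u: "u \<ge> 1" "n = 4 * u + 1" by blast
    let ?c = "word_perm (gamma_word n)"
    obtain R :: "'e \<Rightarrow> 'e" and v :: "nat \<Rightarrow> nat \<Rightarrow> 'e" where
      free: "free_isometric_action G" and R: "linear R"
      and R_pow: "\<And>g. g \<in> G \<Longrightarrow> \<exists>k. linear_part g = R ^^ k"
      and V: "span {v i j | i j. i \<in> {1..n} \<and> j \<in> {1..n} \<and> i \<noteq> j} = UNIV"
      and Rv: "\<And>i j. i \<in> {1..n} \<Longrightarrow> j \<in> {1..n} \<Longrightarrow> i \<noteq> j \<Longrightarrow> R (v i j) = v (?c i) (?c j)"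
      and v_sym: "\<And>i j. v i j = v j i"
      using Gamma_action[OF \<open>n \<ge> 2\<close> assms(5) iso] by blast
    have p: "?c permutes {1..n}" by (rule word_perm_permutes[OF gamma_word[OF \<open>n \<ge> 2\<close>]])
    have Rkv: "(R ^^ k) (v i j) = v ((?c ^^ k) i) ((?c ^^ k) j)"
      if ij: "i \<in> {1..n}" "j \<in> {1..n}" "i \<noteq> j" for i j k
    proof (induction k)
      case (Suc k)
      have q: "(?c ^^ k) permutes {1..n}" by (rule permutes_funpow[OF p])
      have "(?c ^^ k) i \<in> {1..n}" "(?c ^^ k) j \<in> {1..n}" "(?c ^^ k) i \<noteq> (?c ^^ k) j"
        using ij permutes_in_image[OF q] inj_eq[OF permutes_inj[OF q]] by auto
      then show ?case using Suc Rv by simp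
    qed simp
    note c_pow = word_perm_gamma_word_pow[OF \<open>n \<ge> 2\<close>]
    have RL: "linear (R ^^ k)" for k
      by (induction k) (use linear_id linear_compose[OF _ R] in \<open>simp_all only: funpow.simps\<close>)
    have Rn: "R ^^ n = id"
    proof
      fix x
      show "(R ^^ n) x = id x"
        by (rule linear_eq_on[OF RL linear_id, of x "{v i j | i j. i \<in> {1..n} \<and> j \<in> {1..n} \<and> i \<noteq> j}"])
          (use V in \<open>auto simp: Rkv c_pow\<close>)
    qed
    \<comment> \<open>The pair {n - d - 1, n} has cyclic distance d + 1; for d < 2u = (n - 1)/2 this
      gives one representative of each orbit of pairs.\<close>
    define b where "b d = v (n - Suc d) n" for d
    let ?B = "{(R ^^ k) (b d) | k d. k < n \<and> d < 2 * u}"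
    have B_I: "(R ^^ k) (b d) \<in> ?B" if "k < n" "d < 2 * u" for k d
      using that by blast
    have B_less: "v i j \<in> ?B" if ij: "1 \<le> i" "i < j" "j \<le> n" for i j
    proof (cases "j - i \<le> 2 * u")
      case True
      \<comment> \<open>The power n - j carries the point n to the larger index j, and the
        representative at distance j - i to {i, j}.\<close>
      have "(?c ^^ (n - j)) (n + i - j) = i" "(?c ^^ (n - j)) n = j"
        using ij c_pow[of "n + i - j" "n - j"] c_pow[of n "n - j"] by auto
      moreover have "n + i - j \<in> {1..n}" "n \<in> {1..n}" "n + i - j \<noteq> n" using ij by auto
      ultimately have e: "(R ^^ (n - j)) (b (j - i - 1)) = v i j"
        using ij Rkv[of "n + i - j" n "n - j"] by (simp add: b_def)
      have "n - j < n" "j - i - 1 < 2 * u" using True ij u by auto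
      from B_I[OF this] show ?thesis unfolding e .
    next
      case False
      \<comment> \<open>Beyond half the cycle the short way round has length n - (j - i); now n is
        carried to i, and the symmetry of v restores the order of the indices.\<close>
      have "(?c ^^ (n - i)) (j - i) = j" "(?c ^^ (n - i)) n = i"
        using ij c_pow[of "j - i" "n - i"] c_pow[of n "n - i"] by auto
      moreover have "j - i \<in> {1..n}" "n \<in> {1..n}" "j - i \<noteq> n" using ij by auto
      ultimately have e: "(R ^^ (n - i)) (b (n - (j - i) - 1)) = v i j"
        using ij Rkv[of "j - i" n "n - i"] v_sym[of i j] by (simp add: b_def)
      have "n - (j - i) - 1 < 2 * u" "n - i < n" using False ij u by auto
      then have "(R ^^ (n - i)) (b (n - (j - i) - 1)) \<in> ?B" by (intro B_I)
      then show ?thesis unfolding e .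
    qed
    have "v i j \<in> ?B" if "i \<in> {1..n}" "j \<in> {1..n}" "i \<noteq> j" for i j
    proof (cases "i < j")
      case True
      then show ?thesis using B_less[of i j] that by simp
    next
      case False
      then show ?thesis using B_less[of j i] that by (subst v_sym) simp
    qed
    then have "{v i j | i j. i \<in> {1..n} \<and> j \<in> {1..n} \<and> i \<noteq> j} \<subseteq> ?B" by blast
    then have "span ?B = UNIV" using span_mono V by blast
    then obtain K where K: "linear K" "\<And>x. K (K x) = - x" "\<And>x. K (R x) = R (K x)"
      using commuting_complex_structure[OF R Rn, of b u] dim m u by auto
    have K_pow: "K ((R ^^ k) x) = (R ^^ k) (K x)" for k x
      by (induction k) (simp_all add: K(3))
    show "kaehler_manifold (orbit_space G) (orbit_charts G)"
    proof (rule free_isometric_action.kaehler_manifold_orbit_space[OF free K(1,2)])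
      fix g u assume "g \<in> G"
      then obtain k where "linear_part g = R ^^ k" using R_pow by blast
      then show "K (linear_part g u) = linear_part g (K u)" by (simp add: K_pow)
    qed
  qed
qed

end
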